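(* Let $V$ be a finite-dimensional real vector space, let $B$ be a symmetric bilinear form on $V$ having inertia $(n_+,n_-,n_0)$, and define the quadratic form $Q(x)=B(x,x)$. Let $C\subset V$ be a nonempty open convex cone with the property that $Q(x)>0$ for all $x\in C$. Then $n_+\ge 1$, and moreover (with $\beta$ ranging over real numbers): (a) If $n_+=1$ and $n_-=0$, then $Q^{-\beta}$ is completely monotone on $C$ for all $\beta\ge 0$. For all other values of $\beta$, $Q^{-\beta}$ is not completely monotone on any nonempty open convex subcone $C'\subseteq C$. (b) If $n_+=1$ and $n_-\ge 1$, then $Q^{-\beta}$ is completely monotone on $C$ for $\beta=0$ and for all $\beta\ge(n_--1)/2$. For all other values of $\beta$, $Q^{-\beta}$ is not completely monotone on any nonempty open convex subcone $C'\subseteq C$. (c) If $n_+>1$, then $Q^{-\beta}$ is not completely monotone on any nonempty open convex subcone $C'\subseteq C$ for any $\beta\ne 0$.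
   Context: The inertia $(n_+,n_-,n_0)$ of $B$ is the triple of numbers of positive, negative and zero eigenvalues of a matrix representing $B$. Let $C$ be an open convex cone in a finite-dimensional real vector space $V$. A $C^\infty$ function $f\colon C\to\mathbb{R}$ is completely monotone if for all $k\ge 0$, all $\mathbf{u}_1,\ldots,\mathbf{u}_k\in C$ and all $\mathbf{x}\in C$, one has $(-1)^kD_{\mathbf{u}_1}\cdots D_{\mathbf{u}_k}f(\mathbf{x})\ge 0$, where $D_{\mathbf{u}}$ is the directional derivative. Complete monotonicity on a subcone refers to this definition applied to the subcone. *)

theory Defs
  imports "HOL-Analysis.Analysis" "HOL-Computational_Algebra.Computational_Algebra"
    "Jordan_Normal_Form.Char_Poly"
begin

definition is_basis_list :: "'a::real_vector list \<Rightarrow> bool" where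
  "is_basis_list bs \<longleftrightarrow> distinct bs \<and> independent (set bs) \<and> span (set bs) = UNIV"

definition gram_matrix :: "('a \<Rightarrow> 'a \<Rightarrow> real) \<Rightarrow> 'a list \<Rightarrow> real Matrix.mat" where
  "gram_matrix B bs = Matrix.mat (length bs) (length bs) (\<lambda>(i, j). B (bs ! i) (bs ! j))"

(* The eigenvalues with their algebraic multiplicities. Only real roots of the characteristic
   polynomial are collected, which for a real symmetric matrix is all of them. *)
definition eigenvalues_mset :: "real Matrix.mat \<Rightarrow> real multiset" where
  "eigenvalues_mset A = proots (char_poly A)"

(* By Sylvester's law of inertia the triple does not depend on the basis, so requiring the counts
   for some basis is the same as requiring them for every basis. *)
definition has_inertia ::
    "('a::real_vector \<Rightarrow> 'a \<Rightarrow> real) \<Rightarrow> nat \<Rightarrow> nat \<Rightarrow> nat \<Rightarrow> bool" where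
  "has_inertia B np nm n0 \<longleftrightarrow>
     (\<exists>bs. is_basis_list bs \<and>
        np = size {# l \<in># eigenvalues_mset (gram_matrix B bs). l > 0 #} \<and>
        nm = size {# l \<in># eigenvalues_mset (gram_matrix B bs). l < 0 #} \<and>
        n0 = size {# l \<in># eigenvalues_mset (gram_matrix B bs). l = 0 #})"

(* Only strictly positive scalars are used: the library's cone and conic force the apex 0 to
   belong to the set, which for an open set would leave only the whole space. *)
definition open_convex_cone :: "'a::real_normed_vector set \<Rightarrow> bool" where
  "open_convex_cone C \<longleftrightarrow> open C \<and> convex C \<and> (\<forall>x\<in>C. \<forall>c>0. c *\<^sub>R x \<in> C)"

definition dir_deriv :: "'a::real_normed_vector \<Rightarrow> ('a \<Rightarrow> real) \<Rightarrow> 'a \<Rightarrow> real" where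
  "dir_deriv u f x = deriv (\<lambda>t::real. f (x + t *\<^sub>R u)) 0"

(* f is of class C^k on the open set S. Functions on S are represented by total functions;
   the values outside S are irrelevant because S is open. *)
fun Ck_on :: "nat \<Rightarrow> ('a::real_normed_vector \<Rightarrow> real) \<Rightarrow> 'a set \<Rightarrow> bool" where
  "Ck_on 0 f S \<longleftrightarrow> continuous_on S f"
| "Ck_on (Suc k) f S \<longleftrightarrow>
     (\<forall>x\<in>S. f differentiable (at x)) \<and> (\<forall>u. Ck_on k (dir_deriv u f) S)"

definition Cinf_on :: "('a::real_normed_vector \<Rightarrow> real) \<Rightarrow> 'a set \<Rightarrow> bool" where
  "Cinf_on f S \<longleftrightarrow> (\<forall>k. Ck_on k f S)"

(* The list us = [u1, ..., uk] gives the iterated derivative D_u1 (... (D_uk f)). *)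
definition completely_monotone_on :: "'a::real_normed_vector set \<Rightarrow> ('a \<Rightarrow> real) \<Rightarrow> bool" where
  "completely_monotone_on C f \<longleftrightarrow>
     Cinf_on f C \<and>
     (\<forall>us x. set us \<subseteq> C \<longrightarrow> x \<in> C \<longrightarrow> (-1) ^ length us * foldr dir_deriv us f x \<ge> 0)"

end

theory Submission
  imports Defs "HOL-Probability.Sinc_Integral" "HOL-Real_Asymp.Real_Asymp"
begin

text \<open>Complete monotonicity on an open convex cone is equivalent to nonnegativity of all iterated
differences \<open>(1 - E\<^sub>u\<^sub>1) \<dots> (1 - E\<^sub>u\<^sub>k) f\<close>, where \<open>E\<^sub>u\<close> is translation by \<open>u\<close>. The latter
property mentions no derivatives, so it passes at once to products, limits and integrals.

For a Lorentzian form, write \<open>Q = u v - z\<^sub>1\<^sup>2 - \<dots> - z\<^sub>k\<^sup>2\<close> with linear forms and \<open>k = n\<^sub>- - 1\<close>. Then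
\<open>Q\<^bsup>-\<beta>\<^esup> = u\<^bsup>-\<beta>\<^esup> (v - \<bar>z\<bar>\<^sup>2 / u)\<^bsup>-\<beta>\<^esup>\<close>, and repeated use of
\<open>\<integral> (A - 2 w y + w\<^sup>2 u)\<^bsup>-b-1/2\<^esup> dw = const u\<^bsup>-1/2\<^esup> (A - y\<^sup>2 / u)\<^bsup>-b\<^esup>\<close> exhibits it as a positive mixture
of products of powers of linear forms, as long as \<open>\<beta> \<ge> k / 2\<close>.

Conversely, nonnegative differences imply positive definiteness of the kernel
\<open>(a, b) \<mapsto> f (x + a + b)\<close> (for \<open>f\<close> a Laplace transform of a positive measure this says that squares
integrate to nonnegative numbers). If \<open>n\<^sub>+ > 1\<close>, the second difference at \<open>x\<close> along a vector \<open>v\<close>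
with \<open>B x v = 0 < Q v\<close> has the wrong sign. If \<open>0 < \<beta> < (n\<^sub>- - 1) / 2\<close>, choose \<open>m \<le> n\<^sub>-\<close> with
\<open>0 < m - 1 - 2 \<beta> \<le> 1\<close>; for the wave operator \<open>\<box>\<close> of a subspace of signature \<open>(1, m)\<close> one has
\<open>\<box>\<^sup>2 Q\<^bsup>-\<beta>\<^esup> = 4 \<beta> (\<beta> + 1) (m - 1 - 2 \<beta>) (m - 3 - 2 \<beta>) Q\<^bsup>-\<beta>-2\<^esup> < 0\<close>, although \<open>\<box>\<^sup>2\<close> is a square.\<close>

section \<open>Difference operators and arithmetic in open convex cones\<close>

text \<open>The sign is opposite to that of the forward difference, so the factor
  \<open>(-1) ^ k\<close> of complete monotonicity is absorbed.\<close>

definition shift_diff :: "'a::real_vector \<Rightarrow> ('a \<Rightarrow> real) \<Rightarrow> 'a \<Rightarrow> real" where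
  "shift_diff u f x = f x - f (x + u)"

definition diff_monotone_on :: "'a::real_normed_vector set \<Rightarrow> ('a \<Rightarrow> real) \<Rightarrow> bool" where
  "diff_monotone_on C f \<longleftrightarrow>
     (\<forall>us x. set us \<subseteq> C \<longrightarrow> x \<in> C \<longrightarrow> foldr shift_diff us f x \<ge> 0)"

lemma open_convex_cone_add:
  assumes "open_convex_cone C" "x \<in> C" "y \<in> C"
  shows "x + y \<in> C"
proof -
  have "(1/2) *\<^sub>R (2 *\<^sub>R x) + (1/2) *\<^sub>R (2 *\<^sub>R y) \<in> C"
    using assms unfolding open_convex_cone_def by (intro convexD) auto
  then show ?thesis by simp
qed

lemma open_convex_cone_scale:
  "open_convex_cone C \<Longrightarrow> x \<in> C \<Longrightarrow> c > 0 \<Longrightarrow> c *\<^sub>R x \<in> C"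
  by (simp add: open_convex_cone_def)

lemma open_convex_cone_add_scale:
  "open_convex_cone C \<Longrightarrow> x \<in> C \<Longrightarrow> u \<in> C \<Longrightarrow> t \<ge> 0 \<Longrightarrow> x + t *\<^sub>R u \<in> C"
  by (cases "t = 0") (auto intro!: open_convex_cone_add open_convex_cone_scale)

section \<open>Iterated differences\<close>

lemma foldr_shift_diff_cong:
  assumes C: "open_convex_cone C" and eq: "\<And>x. x \<in> C \<Longrightarrow> f x = g x"
    and "set us \<subseteq> C" "x \<in> C"
  shows "foldr shift_diff us f x = foldr shift_diff us g x"
  using assms(3,4)
proof (induction us arbitrary: x)
  case (Cons u us)
  then show ?case
    using open_convex_cone_add[OF C, of x u] by (simp add: shift_diff_def)
qed (simp add: eq)

lemma foldr_shift_diff_add: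
  "foldr shift_diff us (\<lambda>x. f x + g x) x = foldr shift_diff us f x + foldr shift_diff us g x"
  by (induction us arbitrary: x) (auto simp: shift_diff_def)

lemma foldr_shift_diff_cmult:
  "foldr shift_diff us (\<lambda>x. c * f x) x = c * foldr shift_diff us f x"
  by (induction us arbitrary: x) (auto simp: shift_diff_def algebra_simps)

lemma foldr_shift_diff_shift:
  "foldr shift_diff us (\<lambda>x. f (x + a)) x = foldr shift_diff us f (x + a)"
  by (induction us arbitrary: x) (auto simp: shift_diff_def algebra_simps)

text \<open>An iterated difference is a finite linear combination of values at points of
  \<open>C\<close>, so pointwise convergence on \<open>C\<close> is enough.\<close>

lemma foldr_shift_diff_tendsto:
  assumes C: "open_convex_cone C" and lim: "\<And>x. x \<in> C \<Longrightarrow> ((\<lambda>n. g n x) \<longlongrightarrow> f x) F"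
    and "set us \<subseteq> C" "x \<in> C"
  shows "((\<lambda>n. foldr shift_diff us (g n) x) \<longlongrightarrow> foldr shift_diff us f x) F"
  using assms(3,4)
proof (induction us arbitrary: x)
  case (Cons u us)
  then show ?case
    using open_convex_cone_add[OF C, of x u] by (auto simp: shift_diff_def intro!: tendsto_diff)
qed (simp add: lim)

text \<open>Both claims are proved in one induction, because splitting the integral of a difference
  requires both of its terms to be integrable.\<close>

lemma foldr_shift_diff_integral:
  assumes C: "open_convex_cone C" and int: "\<And>x. x \<in> C \<Longrightarrow> integrable M (\<lambda>w. g w x)"
    and "set us \<subseteq> C" "x \<in> C"
  shows "integrable M (\<lambda>w. foldr shift_diff us (g w) x) \<and>
    foldr shift_diff us (\<lambda>x. \<integral>w. g w x \<partial>M) x = (\<integral>w. foldr shift_diff us (g w) x \<partial>M)"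
  using assms(3,4)
proof (induction us arbitrary: x)
  case (Cons u us)
  then show ?case
    using open_convex_cone_add[OF C, of x u] by (auto simp: shift_diff_def)
qed (simp add: int)

lemma diff_monotone_on_nonneg: "diff_monotone_on C f \<Longrightarrow> x \<in> C \<Longrightarrow> f x \<ge> 0"
  unfolding diff_monotone_on_def by (drule spec[of _ "[]"]) simp

lemma diff_monotone_on_shift_diff:
  "diff_monotone_on C f \<Longrightarrow> u \<in> C \<Longrightarrow> diff_monotone_on C (shift_diff u f)"
  unfolding diff_monotone_on_def
proof (intro allI impI)
  fix us x
  assume *: "\<forall>us x. set us \<subseteq> C \<longrightarrow> x \<in> C \<longrightarrow> 0 \<le> foldr shift_diff us f x" "u \<in> C" "set us \<subseteq> C" "x \<in> C"
  \<comment> \<open>\<open>foldr\<close> applies the last list entry first, so the inner difference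
    is appended at the end.\<close>
  show "0 \<le> foldr shift_diff us (shift_diff u f) x"
    using *(1)[rule_format, of "us @ [u]" x] *(2-) by simp
qed

lemma diff_monotone_on_shift:
  assumes "open_convex_cone C" "diff_monotone_on C f" "a \<in> C"
  shows "diff_monotone_on C (\<lambda>x. f (x + a))"
  using assms open_convex_cone_add[OF assms(1)]
  by (auto simp: diff_monotone_on_def foldr_shift_diff_shift)

lemma diff_monotone_on_cong:
  assumes "open_convex_cone C" "\<And>x. x \<in> C \<Longrightarrow> f x = g x"
  shows "diff_monotone_on C f \<longleftrightarrow> diff_monotone_on C g"
  using foldr_shift_diff_cong[OF assms] by (simp add: diff_monotone_on_def)

lemma diff_monotone_on_cmult:
  "diff_monotone_on C f \<Longrightarrow> c \<ge> 0 \<Longrightarrow> diff_monotone_on C (\<lambda>x. c * f x)"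
  by (simp add: diff_monotone_on_def foldr_shift_diff_cmult)

text \<open>Discrete Leibniz rule: a difference of \<open>f * g\<close> is a sum of two products
  whose factors are differences or translates of \<open>f\<close> and \<open>g\<close>, hence of the
  same class. The induction therefore runs over all pairs \<open>f\<close>,
  \<open>g\<close>.\<close>

lemma diff_monotone_on_mult:
  assumes C: "open_convex_cone C" and "diff_monotone_on C f" "diff_monotone_on C g"
  shows "diff_monotone_on C (\<lambda>x. f x * g x)"
proof -
  have "foldr shift_diff us (\<lambda>x. f x * g x) x \<ge> 0"
    if "set us \<subseteq> C" "x \<in> C" "diff_monotone_on C f" "diff_monotone_on C g" for us x f g
    using that
  proof (induction us arbitrary: x f g rule: rev_induct)
    case (snoc u us)
    have *: "shift_diff u (\<lambda>x. f x * g x) =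
        (\<lambda>x. shift_diff u f x * g x + f (x + u) * shift_diff u g x)"
      by (auto simp: shift_diff_def algebra_simps)
    have "0 \<le> foldr shift_diff us (\<lambda>x. shift_diff u f x * g x) x"
      "0 \<le> foldr shift_diff us (\<lambda>x. f (x + u) * shift_diff u g x) x"
      using snoc.prems by (auto intro!: snoc.IH diff_monotone_on_shift_diff diff_monotone_on_shift[OF C])
    then show ?case by (simp add: * foldr_shift_diff_add)
  qed (auto intro: mult_nonneg_nonneg diff_monotone_on_nonneg)
  then show ?thesis using assms by (simp add: diff_monotone_on_def)
qed

lemma diff_monotone_on_integral:
  assumes C: "open_convex_cone C" and int: "\<And>x. x \<in> C \<Longrightarrow> integrable M (\<lambda>w. g w x)"
    and "\<And>w. diff_monotone_on C (g w)"
  shows "diff_monotone_on C (\<lambda>x. \<integral>w. g w x \<partial>M)"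
  unfolding diff_monotone_on_def
proof (intro allI impI)
  fix us x assume *: "set us \<subseteq> C" "x \<in> C"
  show "0 \<le> foldr shift_diff us (\<lambda>x. \<integral>w. g w x \<partial>M) x"
    using foldr_shift_diff_integral[of C M g, OF C int *] assms(3) *
    by (auto simp: diff_monotone_on_def intro!: integral_nonneg)
qed

section \<open>Smoothness\<close>

lemma dir_deriv_eqI:
  "((\<lambda>t. f (x + t *\<^sub>R u)) has_real_derivative D) (at 0) \<Longrightarrow> dir_deriv u f x = D"
  by (simp add: dir_deriv_def DERIV_imp_deriv)

lemma has_derivative_imp_line_DERIV:
  assumes "(f has_derivative f') (at (x + t *\<^sub>R u))"
  shows "((\<lambda>t. f (x + t *\<^sub>R u)) has_real_derivative f' u) (at t)"
proof -
  have "((\<lambda>t. x + t *\<^sub>R u) has_derivative (\<lambda>s. s *\<^sub>R u)) (at t)"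
    by (auto intro!: derivative_eq_intros)
  from diff_chain_at[OF this assms] have "((\<lambda>t. f (x + t *\<^sub>R u)) has_derivative (\<lambda>s. f' (s *\<^sub>R u))) (at t)"
    by (simp add: o_def)
  moreover have "(\<lambda>s. f' (s *\<^sub>R u)) = (\<lambda>s. s * f' u)"
    using has_derivative_bounded_linear[OF assms] by (simp add: linear_simps)
  ultimately show ?thesis by (simp add: has_field_derivative_def mult_commute_abs)
qed

lemma dir_deriv_has_derivative:
  "(f has_derivative f') (at x) \<Longrightarrow> dir_deriv u f x = f' u"
  using has_derivative_imp_line_DERIV[of f f' x 0 u] by (intro dir_deriv_eqI) simp

lemma differentiable_line_DERIV:
  assumes "f differentiable (at (x + t *\<^sub>R u))"
  shows "((\<lambda>t. f (x + t *\<^sub>R u)) has_real_derivative dir_deriv u f (x + t *\<^sub>R u)) (at t)"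
proof -
  obtain f' where f': "(f has_derivative f') (at (x + t *\<^sub>R u))"
    using assms unfolding differentiable_def by blast
  show ?thesis
    using has_derivative_imp_line_DERIV[OF f'] dir_deriv_has_derivative[OF f'] by simp
qed

lemma dir_deriv_cong:
  assumes "open S" "x \<in> S" "\<And>y. y \<in> S \<Longrightarrow> f y = g y"
  shows "dir_deriv u f x = dir_deriv u g x"
proof -
  have "((\<lambda>t. x + t *\<^sub>R u) \<longlongrightarrow> x + 0 *\<^sub>R u) (at 0)" by (intro tendsto_intros)
  then have "\<forall>\<^sub>F t in at 0. x + t *\<^sub>R u \<in> S"
    using assms(1,2) by (intro topological_tendstoD) auto
  then have "\<forall>\<^sub>F t in nhds 0. f (x + t *\<^sub>R u) = g (x + t *\<^sub>R u)"
    using assms(2,3) by (auto simp: eventually_at_filter elim!: eventually_mono)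
  then show ?thesis unfolding dir_deriv_def by (intro deriv_cong_ev) auto
qed

lemma differentiable_cong_open:
  assumes "open S" "x \<in> S" "\<And>y. y \<in> S \<Longrightarrow> f y = g y" "f differentiable (at x)"
  shows "g differentiable (at x)"
proof -
  obtain f' where "(f has_derivative f') (at x)" using assms(4) unfolding differentiable_def by blast
  then have "(g has_derivative f') (at x)"
    by (rule has_derivative_transform_within_open[OF _ assms(1,2,3)])
  then show ?thesis unfolding differentiable_def by blast
qed

text \<open>Derivative formulas hold only on \<open>S\<close>, while \<open>Ck_on\<close> speaks of
  total functions; since \<open>S\<close> is open, a derivative may be replaced by its formula
  there.\<close>

lemma Ck_on_cong:
  assumes "open S" "Ck_on k f S" "\<And>y. y \<in> S \<Longrightarrow> g y = f y"
  shows "Ck_on k g S"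
  using assms(2,3)
proof (induction k arbitrary: f g)
  case 0
  then show ?case by (simp cong: continuous_on_cong)
next
  case (Suc k)
  have "Ck_on k (dir_deriv u g) S" for u
  proof (rule Suc.IH)
    show "Ck_on k (dir_deriv u f) S" using Suc.prems(1) by simp
    show "dir_deriv u g y = dir_deriv u f y" if "y \<in> S" for y
      using \<open>open S\<close> that Suc.prems(2) by (rule dir_deriv_cong)
  qed
  moreover have "g differentiable (at x)" if "x \<in> S" for x
  proof (rule differentiable_cong_open[OF \<open>open S\<close> that])
    show "f y = g y" if "y \<in> S" for y using Suc.prems(2)[OF that] by simp
    show "f differentiable (at x)" using Suc.prems(1) that by simp
  qed
  ultimately show ?case by simp
qed

lemma Ck_on_SucD: "Ck_on (Suc k) f S \<Longrightarrow> Ck_on k f S"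
proof (induction k arbitrary: f)
  case 0
  then show ?case
    by (simp add: continuous_at_imp_continuous_on differentiable_imp_continuous_within)
next
  case (Suc k)
  have "Ck_on k (dir_deriv u f) S" for u
    using Suc.prems unfolding Ck_on.simps(2)[of "Suc k" f] by (intro Suc.IH) blast
  moreover have "\<forall>x\<in>S. f differentiable (at x)" using Suc.prems by simp
  ultimately show ?case unfolding Ck_on.simps(2)[of k f] by blast
qed

lemma Ck_on_const: "Ck_on k (\<lambda>x. c) S"
proof (induction k arbitrary: c)
  case (Suc k)
  have "dir_deriv u (\<lambda>x. c) = (\<lambda>x. 0)" for u :: 'a
    by (auto simp: dir_deriv_def)
  then show ?case using Suc by simp
qed auto

lemma Ck_on_bounded_linear:
  assumes "bounded_linear l" shows "Ck_on k l S"
proof (cases k)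
  case 0
  then show ?thesis using assms by (simp add: linear_continuous_on)
next
  case (Suc k)
  have l: "(l has_derivative l) (at x)" for x
    using assms by (rule bounded_linear_imp_has_derivative)
  then have "dir_deriv u l = (\<lambda>x. l u)" for u
    by (auto simp: dir_deriv_has_derivative)
  moreover have "l differentiable (at x)" for x using l unfolding differentiable_def by blast
  ultimately show ?thesis using Suc by (simp add: Ck_on_const)
qed

lemma Ck_on_add:
  assumes "open S" "Ck_on k f S" "Ck_on k g S"
  shows "Ck_on k (\<lambda>x. f x + g x) S"
  using assms(2,3)
proof (induction k arbitrary: f g)
  case (Suc k)
  have eq: "dir_deriv u (\<lambda>x. f x + g x) x = dir_deriv u f x + dir_deriv u g x" if "x \<in> S" for u x
    using Suc.prems that differentiable_line_DERIV[of f x 0 u] differentiable_line_DERIV[of g x 0 u]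
    by (intro dir_deriv_eqI DERIV_add) auto
  have ck: "Ck_on k (\<lambda>x. dir_deriv u f x + dir_deriv u g x) S" for u
    using Suc by auto
  have "Ck_on k (dir_deriv u (\<lambda>x. f x + g x)) S" for u
    by (rule Ck_on_cong[OF \<open>open S\<close> ck eq])
  then show ?case using Suc.prems by auto
qed (auto intro: continuous_intros)

lemma Ck_on_mult:
  assumes "open S" "Ck_on k f S" "Ck_on k g S"
  shows "Ck_on k (\<lambda>x. f x * g x) S"
  using assms(2,3)
proof (induction k arbitrary: f g)
  case (Suc k)
  have eq: "dir_deriv u (\<lambda>x. f x * g x) x = dir_deriv u f x * g x + f x * dir_deriv u g x" if "x \<in> S" for u x
    using Suc.prems that DERIV_mult[OF differentiable_line_DERIV[of f x 0 u] differentiable_line_DERIV[of g x 0 u]]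
    by (intro dir_deriv_eqI) (auto simp: algebra_simps)
  have ck: "Ck_on k (\<lambda>x. dir_deriv u f x * g x + f x * dir_deriv u g x) S" for u
    using Suc.prems Ck_on_SucD[of k f S] Ck_on_SucD[of k g S] by (intro Ck_on_add[OF \<open>open S\<close>] Suc.IH) auto
  have "Ck_on k (dir_deriv u (\<lambda>x. f x * g x)) S" for u
    by (rule Ck_on_cong[OF \<open>open S\<close> ck eq])
  then show ?case using Suc.prems by auto
qed (auto intro: continuous_intros)

lemma dir_deriv_powr:
  assumes "g differentiable (at x)" "g x > 0"
  shows "dir_deriv u (\<lambda>x. g x powr a) x = a * g x powr (a - 1) * dir_deriv u g x"
  using DERIV_fun_powr[OF differentiable_line_DERIV[of g x 0 u], of a] assms
  by (intro dir_deriv_eqI) simp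

text \<open>The induction covers all exponents at once, because differentiation lowers
  \<open>a\<close> to \<open>a - 1\<close>.\<close>

lemma Ck_on_powr:
  assumes "open S" "Ck_on k g S" "\<And>x. x \<in> S \<Longrightarrow> g x > 0"
  shows "Ck_on k (\<lambda>x. g x powr a) S"
  using assms(2)
proof (induction k arbitrary: a)
  case 0
  have "\<forall>x\<in>S. g x \<noteq> 0" using assms(3) by fastforce
  with 0 show ?case by (simp add: continuous_on_powr)
next
  case (Suc k)
  have ck: "Ck_on k (\<lambda>x. a * g x powr (a - 1) * dir_deriv u g x) S" for u
    using Suc.prems Ck_on_SucD[OF Suc.prems]
    by (intro Ck_on_mult[OF \<open>open S\<close>] Ck_on_const Suc.IH) auto
  have eq: "dir_deriv u (\<lambda>x. g x powr a) x = a * g x powr (a - 1) * dir_deriv u g x" if "x \<in> S" for u x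
    using that Suc.prems assms(3) by (intro dir_deriv_powr) auto
  have "Ck_on k (dir_deriv u (\<lambda>x. g x powr a)) S" for u
    by (rule Ck_on_cong[OF \<open>open S\<close> ck eq])
  moreover have "(\<lambda>x. g x powr a) differentiable (at x)" if x: "x \<in> S" for x
  proof -
    obtain g' where "(g has_derivative g') (at x)" using Suc.prems x unfolding differentiable_def Ck_on.simps by blast
    from has_derivative_powr[OF this, of "\<lambda>_. a" "\<lambda>_. 0"] show ?thesis
      using assms(3)[OF x] by (auto simp: differentiable_def)
  qed
  ultimately show ?case by auto
qed

lemma Cinf_on_SucD: "Cinf_on f S \<Longrightarrow> Ck_on (Suc k) f S"
  unfolding Cinf_on_def by blast

lemma Cinf_on_dir_deriv: "Cinf_on f S \<Longrightarrow> Cinf_on (dir_deriv u f) S"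
  using Cinf_on_SucD[of f S] unfolding Cinf_on_def[of "dir_deriv u f"] Ck_on.simps(2) by blast

lemma Cinf_on_foldr_dir_deriv: "Cinf_on f S \<Longrightarrow> Cinf_on (foldr dir_deriv us f) S"
  by (induction us) (auto simp: Cinf_on_dir_deriv)

lemma Cinf_on_differentiable: "Cinf_on f S \<Longrightarrow> x \<in> S \<Longrightarrow> f differentiable (at x)"
  using Cinf_on_SucD[of f S 0] by simp

section \<open>Derivatives and differences\<close>

text \<open>With \<open>m = Suc n\<close>, the scaled difference of \<open>s * f\<close> along
  \<open>u / m\<close>, multiplied by \<open>m\<close>, has nonnegative iterated differences and
  tends pointwise to the negated derivative. The factor \<open>s\<close> records the sign so that
  the lemma can be iterated.\<close>

lemma diff_monotone_on_dir_deriv: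
  assumes C: "open_convex_cone C" and f: "Cinf_on f C"
    and mono: "diff_monotone_on C (\<lambda>x. s * f x)" and u: "u \<in> C"
  shows "diff_monotone_on C (\<lambda>x. - s * dir_deriv u f x)"
  unfolding diff_monotone_on_def
proof (intro allI impI)
  fix vs x assume *: "set vs \<subseteq> C" "x \<in> C"
  define g where "g n = (\<lambda>x. real (Suc n) * shift_diff (inverse (real (Suc n)) *\<^sub>R u) (\<lambda>x. s * f x) x)" for n
  have lim: "(\<lambda>n. g n y) \<longlonglongrightarrow> - s * dir_deriv u f y" if y: "y \<in> C" for y
  proof -
    have "((\<lambda>t. f (y + t *\<^sub>R u)) has_real_derivative dir_deriv u f y) (at 0)"
      using differentiable_line_DERIV[of f y 0 u] Cinf_on_differentiable[OF f y] by simp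
    then have "((\<lambda>t. (f (y + t *\<^sub>R u) - f y) / t) \<longlongrightarrow> dir_deriv u f y) (at 0)"
      by (simp add: has_field_derivative_iff)
    moreover have "filterlim (\<lambda>n. inverse (real (Suc n))) (at 0) sequentially"
      unfolding filterlim_at using LIMSEQ_inverse_real_of_nat by auto
    ultimately have "(\<lambda>n. (f (y + inverse (real (Suc n)) *\<^sub>R u) - f y) / inverse (real (Suc n)))
        \<longlonglongrightarrow> dir_deriv u f y"
      by (rule filterlim_compose)
    then have "(\<lambda>n. - s * ((f (y + inverse (real (Suc n)) *\<^sub>R u) - f y) / inverse (real (Suc n))))
        \<longlonglongrightarrow> - s * dir_deriv u f y"
      by (intro tendsto_intros)
    then show ?thesis
      by (simp add: g_def shift_diff_def divide_inverse algebra_simps)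
  qed
  have "foldr shift_diff vs (g n) x \<ge> 0" for n
  proof -
    have "inverse (real (Suc n)) *\<^sub>R u \<in> C"
      using open_convex_cone_scale[OF C u] by simp
    from diff_monotone_on_cmult[OF diff_monotone_on_shift_diff[OF mono this], of "real (Suc n)"] *
    show ?thesis unfolding g_def diff_monotone_on_def by simp
  qed
  moreover have "(\<lambda>n. foldr shift_diff vs (g n) x) \<longlonglongrightarrow> foldr shift_diff vs (\<lambda>x. - s * dir_deriv u f x) x"
    by (rule foldr_shift_diff_tendsto[OF C lim *])
  ultimately show "0 \<le> foldr shift_diff vs (\<lambda>x. - s * dir_deriv u f x) x"
    by (intro LIMSEQ_le_const) auto
qed

text \<open>Derivatives are peeled off innermost first, each of them turning \<open>s\<close> into
  \<open>- s\<close>.\<close>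

lemma diff_monotone_on_imp_completely_monotone_on:
  assumes C: "open_convex_cone C" and "Cinf_on f C" "diff_monotone_on C f"
  shows "completely_monotone_on C f"
proof -
  have "s * (-1) ^ length us * foldr dir_deriv us f x \<ge> 0"
    if "Cinf_on f C" "diff_monotone_on C (\<lambda>x. s * f x)" "set us \<subseteq> C" "x \<in> C" for s us f x
    using that
  proof (induction us arbitrary: s f rule: rev_induct)
    case Nil
    then show ?case using diff_monotone_on_nonneg[of C "\<lambda>x. s * f x" x] by simp
  next
    case (snoc u us)
    have "0 \<le> - s * (-1) ^ length us * foldr dir_deriv us (dir_deriv u f) x"
      using snoc.prems by (intro snoc.IH Cinf_on_dir_deriv diff_monotone_on_dir_deriv[OF C]) auto
    then show ?case by simp
  qed
  from this[of f 1] assms show ?thesis by (simp add: completely_monotone_on_def)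
qed

text \<open>Differences commute with directional derivatives. For \<open>t \<ge> 0\<close> the ray
  from \<open>x\<close> along \<open>v\<close> stays in \<open>C\<close>, where \<open>g\<close> is
  differentiable.\<close>

lemma foldr_shift_diff_line_DERIV:
  assumes C: "open_convex_cone C"
    and g: "\<And>y. y \<in> C \<Longrightarrow> g differentiable (at y)"
    and v: "v \<in> C" and "set us \<subseteq> C" "x \<in> C" "t \<ge> 0"
  shows "((\<lambda>t. foldr shift_diff us g (x + t *\<^sub>R v)) has_real_derivative
    foldr shift_diff us (dir_deriv v g) (x + t *\<^sub>R v)) (at t)"
  using assms(4,5)
proof (induction us arbitrary: x)
  case Nil
  then show ?case
    using differentiable_line_DERIV[of g x t v] g open_convex_cone_add_scale[OF C _ v \<open>t \<ge> 0\<close>] by simp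
next
  case (Cons u us)
  have "x + u \<in> C" using Cons.prems open_convex_cone_add[OF C] by simp
  then have "((\<lambda>t. foldr shift_diff us g (x + t *\<^sub>R v) - foldr shift_diff us g ((x + u) + t *\<^sub>R v))
      has_real_derivative foldr shift_diff us (dir_deriv v g) (x + t *\<^sub>R v)
        - foldr shift_diff us (dir_deriv v g) ((x + u) + t *\<^sub>R v)) (at t)"
    using Cons by (intro DERIV_diff) auto
  then show ?case by (simp add: shift_diff_def[of u] add_ac)
qed

text \<open>Differences are traded one at a time for derivatives: along the segment from
  \<open>x\<close> to \<open>x + u\<close>, the slope is a mixed expression with one derivative more
  and one difference fewer, whose sign is known by induction.\<close>

lemma completely_monotone_on_imp_diff_monotone_on:
  assumes C: "open_convex_cone C" and cm: "completely_monotone_on C f"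
  shows "diff_monotone_on C f"
proof -
  have f: "Cinf_on f C" using cm by (simp add: completely_monotone_on_def)
  have main: "(-1) ^ length ds * foldr shift_diff us (foldr dir_deriv ds f) x \<ge> 0"
    if "set us \<subseteq> C" "set ds \<subseteq> C" "x \<in> C" for us ds x
    using that
  proof (induction us arbitrary: ds x)
    case Nil
    then show ?case using cm by (simp add: completely_monotone_on_def)
  next
    case (Cons u us)
    define G where "G t = (-1) ^ length ds * foldr shift_diff us (foldr dir_deriv ds f) (x + t *\<^sub>R u)" for t
    define G' where "G' t = (-1) ^ length ds * foldr shift_diff us (foldr dir_deriv (u # ds) f) (x + t *\<^sub>R u)" for t
    have "G 1 \<le> G 0"
    proof (rule DERIV_nonpos_imp_nonincreasing[of 0 1 G])
      fix t :: real assume t: "0 \<le> t" "t \<le> 1"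
      have "(G has_real_derivative G' t) (at t)"
        unfolding G_def G'_def foldr.simps o_def using Cons.prems t
        by (intro DERIV_cmult foldr_shift_diff_line_DERIV[OF C]
            Cinf_on_differentiable[OF Cinf_on_foldr_dir_deriv[OF f]]) auto
      moreover have "G' t \<le> 0"
        using Cons.IH[of "u # ds" "x + t *\<^sub>R u"] Cons.prems open_convex_cone_add_scale[OF C, of x u t] t
        by (simp add: G'_def)
      ultimately show "\<exists>y. (G has_real_derivative y) (at t) \<and> y \<le> 0" by blast
    qed simp
    then show ?case by (simp add: G_def shift_diff_def[of u] algebra_simps)
  qed
  show ?thesis unfolding diff_monotone_on_def using main[of _ "[]"] by simp
qed

text \<open>Differentiating the \<open>k\<close>-th derivative along \<open>u\<close> contributes
  the factor \<open>- (s + k) * l u\<close>. Since \<open>l u > 0\<close> on \<open>C\<close>, only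
  the sign alternates.\<close>

lemma foldr_dir_deriv_linear_powr:
  assumes C: "open C" and l: "bounded_linear l" and pos: "\<And>x. x \<in> C \<Longrightarrow> l x > 0"
    and "s \<ge> 0" "set us \<subseteq> C"
  shows "\<exists>c\<ge>0. \<forall>x\<in>C. (-1) ^ length us * foldr dir_deriv us (\<lambda>x. l x powr (- s)) x = c * l x powr (- s - real (length us))"
  using assms(5)
proof (induction us)
  case Nil
  show ?case by (intro exI[of _ 1]) simp
next
  case (Cons u us)
  obtain c where c: "c \<ge> 0" "\<And>x. x \<in> C \<Longrightarrow> (-1) ^ length us * foldr dir_deriv us (\<lambda>x. l x powr (- s)) x
      = c * l x powr (- s - real (length us))" using Cons by auto
  have eq: "foldr dir_deriv us (\<lambda>x. l x powr (- s)) x = (-1) ^ length us * c * l x powr (- s - real (length us))"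
    if "x \<in> C" for x
    using c(2)[OF that, symmetric] by (simp add: mult.assoc flip: power_add mult_2)
  have l': "(l has_derivative l) (at x)" for x
    using l by (rule bounded_linear_imp_has_derivative)
  then have ld: "l differentiable (at x)" for x unfolding differentiable_def by blast
  show ?case
  proof (intro exI conjI ballI)
    show "c * (s + real (length us)) * l u \<ge> 0"
      using c(1) \<open>s \<ge> 0\<close> pos[of u] Cons.prems by (simp add: less_imp_le)
    fix x assume x: "x \<in> C"
    have "((\<lambda>t. l (x + t *\<^sub>R u) powr (- s - real (length us))) has_real_derivative
        (- s - real (length us)) * l x powr (- s - real (length us) - 1) * l u) (at 0)"
      using DERIV_fun_powr[OF differentiable_line_DERIV[of l x 0 u], of "- s - real (length us)"]
        pos[OF x] ld dir_deriv_has_derivative[OF l'] by simp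
    then have "dir_deriv u (\<lambda>x. (-1) ^ length us * c * l x powr (- s - real (length us))) x =
        (-1) ^ length us * c * ((- s - real (length us)) * l x powr (- s - real (length us) - 1) * l u)"
      by (intro dir_deriv_eqI DERIV_cmult)
    then have *: "foldr dir_deriv (u # us) (\<lambda>x. l x powr (- s)) x =
      (-1) ^ length us * c * ((- s - real (length us)) * l x powr (- s - real (length us) - 1) * l u)"
      using dir_deriv_cong[OF C x eq] by simp
    show "(-1) ^ length (u # us) * foldr dir_deriv (u # us) (\<lambda>x. l x powr (- s)) x =
      c * (s + real (length us)) * l u * l x powr (- s - real (length (u # us)))"
      unfolding * by (cases "even (length us)") (simp_all add: algebra_simps)
  qed
qed

text \<open>These powers are the building blocks of all later products and mixtures.\<close>

lemma diff_monotone_on_linear_powr: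
  assumes C: "open_convex_cone C" and l: "bounded_linear l" and pos: "\<And>x. x \<in> C \<Longrightarrow> l x > 0"
    and s: "s \<ge> 0"
  shows "diff_monotone_on C (\<lambda>x. l x powr (- s))"
proof (rule completely_monotone_on_imp_diff_monotone_on[OF C])
  have "open C" using C by (simp add: open_convex_cone_def)
  show "completely_monotone_on C (\<lambda>x. l x powr (- s))"
    unfolding completely_monotone_on_def Cinf_on_def
  proof (intro conjI allI impI)
    show "Ck_on k (\<lambda>x. l x powr (- s)) C" for k
      using \<open>open C\<close> l pos by (intro Ck_on_powr Ck_on_bounded_linear)
    fix us x assume "set us \<subseteq> C" "x \<in> C"
    then show "0 \<le> (-1) ^ length us * foldr dir_deriv us (\<lambda>x. l x powr (- s)) x"
      using foldr_dir_deriv_linear_powr[OF \<open>open C\<close> l pos s] by fastforce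
  qed
qed

section \<open>Positive definiteness\<close>

text \<open>Let \<open>X = \<Sum> c\<^sub>i X\<^sub>i\<close> with independent Bernoulli variables \<open>X\<^sub>i\<close> whose formal success
probability \<open>p\<^sub>i\<close> is the translation by \<open>a\<^sub>i\<close>. The left-hand side is the
expectation of \<open>(s + X)\<^sup>2\<close>, written as a polynomial in the \<open>p\<^sub>i\<close> and applied to \<open>f\<close>. Expanding over the
outcomes instead exhibits it as a combination of products of \<open>p\<^sub>i\<close> and \<open>1 - p\<^sub>i\<close> with coefficients
that are squares.\<close>

lemma diff_monotone_on_bernoulli:
  fixes f :: "'a::real_normed_vector \<Rightarrow> real"
  assumes C: "open_convex_cone C"
  assumes "diff_monotone_on C f" "x \<in> C" "snd ` set ps \<subseteq> C"
  shows "s\<^sup>2 * f x + 2 * s * (\<Sum>(c, a)\<leftarrow>ps. c * f (x + a))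
    + (\<Sum>(c, a)\<leftarrow>ps. \<Sum>(d, b)\<leftarrow>ps. c * d * f (x + a + b))
    + (\<Sum>(c, a)\<leftarrow>ps. c\<^sup>2 * (f (x + a) - f (x + a + a))) \<ge> 0"
    (is "?E s f ps \<ge> 0")
  using assms(2-)
proof (induction ps arbitrary: s f)
  case Nil
  then show ?case using diff_monotone_on_nonneg by fastforce
next
  case (Cons p ps)
  obtain c a where p: "p = (c, a)" by fastforce
  have a: "a \<in> C" using Cons.prems p by simp
  have "0 \<le> ?E (s + c) (\<lambda>x. f (x + a)) ps" "0 \<le> ?E s (shift_diff a f) ps"
    using Cons.prems a
    by (intro Cons.IH diff_monotone_on_shift[OF C] diff_monotone_on_shift_diff; simp)+
  moreover have "?E (s + c) (\<lambda>x. f (x + a)) ps + ?E s (shift_diff a f) ps = ?E s f (p # ps)"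
    unfolding p shift_diff_def
    by (simp add: case_prod_beta sum_list_addf sum_list_subtractf sum_list_const_mult
        algebra_simps power2_eq_square)
  ultimately show ?case by linarith
qed


lemma sum_list_concat_replicate:
  "(\<Sum>x\<leftarrow>concat (replicate n xs). f x) = real n * (\<Sum>x\<leftarrow>xs. f x)"
  by (induction n) (auto simp: algebra_simps)

text \<open>A law of large numbers: replacing each Bernoulli term by \<open>n\<close> independent
  copies of weight \<open>c i / n\<close> preserves the double sum, while the diagonal correction
  shrinks like \<open>1 / n\<close>.\<close>

lemma diff_monotone_on_positive_definite:
  fixes f :: "'a::real_normed_vector \<Rightarrow> real"
  assumes C: "open_convex_cone C" and f: "diff_monotone_on C f" and x: "x \<in> C"
    and I: "finite I" and a: "a ` I \<subseteq> C"
  shows "(\<Sum>i\<in>I. \<Sum>j\<in>I. c i * c j * f (x + a i + a j)) \<ge> 0" (is "?M \<ge> 0")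
proof -
  obtain xs where xs: "distinct xs" "set xs = I" using finite_distinct_list[OF I] by blast
  define D where "D = (\<Sum>i\<in>I. (c i)\<^sup>2 * (f (x + a i) - f (x + a i + a i)))"
  have "?M + inverse (real (Suc n)) * D \<ge> 0" for n
  proof -
    define ps where "ps = concat (replicate (Suc n) (map (\<lambda>i. (c i / real (Suc n), a i)) xs))"
    have sum: "(\<Sum>p\<leftarrow>ps. h p) = real (Suc n) * (\<Sum>i\<in>I. h (c i / real (Suc n), a i))" for h :: "real \<times> 'a \<Rightarrow> real"
      using xs unfolding ps_def sum_list_concat_replicate
      by (simp add: o_def sum_list_distinct_conv_sum_set)
    define N where "N = real (Suc n)"
    have N: "N \<noteq> 0" by (simp add: N_def)
    have "snd ` set ps \<subseteq> C" using a xs by (auto simp: ps_def)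
    \<comment> \<open>With \<open>s = 0\<close> only the quadratic terms survive.\<close>
    from diff_monotone_on_bernoulli[OF C f x this, of 0]
    have "0 \<le> N * (\<Sum>i\<in>I. N * (\<Sum>j\<in>I. c i / N * (c j / N) * f (x + a i + a j)))
        + N * (\<Sum>i\<in>I. (c i / N)\<^sup>2 * (f (x + a i) - f (x + a i + a i)))"
      by (simp add: sum N_def[symmetric] case_prod_beta del: of_nat_Suc)
    also have "N * (\<Sum>i\<in>I. N * (\<Sum>j\<in>I. c i / N * (c j / N) * f (x + a i + a j))) = ?M"
      using N by (simp add: sum_distrib_left field_simps)
    also have "N * (\<Sum>i\<in>I. (c i / N)\<^sup>2 * (f (x + a i) - f (x + a i + a i))) = inverse N * D"
      unfolding D_def sum_distrib_left using N by (intro sum.cong refl) (simp add: power2_eq_square divide_inverse_commute)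
    finally show ?thesis by (simp add: N_def)
  qed
  moreover have "(\<lambda>n. ?M + inverse (real (Suc n)) * D) \<longlonglongrightarrow> ?M + 0 * D"
    by (intro tendsto_intros LIMSEQ_inverse_real_of_nat)
  ultimately show ?thesis by (intro LIMSEQ_le_const[of _ ?M 0]) auto
qed

section \<open>Mixtures of powers of linear forms\<close>

text \<open>The bound \<open>b \<ge> 1\<close> makes \<open>1 / (1 + w^2)\<close> a majorant; the
  mixtures below use exponents \<open>b + 1/2\<close> with \<open>b \<ge> 1/2\<close>.\<close>

lemma integrable_one_plus_square_powr:
  assumes "b \<ge> 1"
  shows "integrable lborel (\<lambda>w::real. (1 + w\<^sup>2) powr (- b))"
proof (rule Bochner_Integration.integrable_bound)
  show "integrable lborel (\<lambda>w::real. inverse (1 + w\<^sup>2))"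
    using integrable_inverse_1_plus_square by (simp add: set_integrable_def)
  have "(1 + w\<^sup>2) powr (- b) \<le> inverse (1 + w\<^sup>2)" for w :: real
    using powr_mono[of "- b" "-1" "1 + w\<^sup>2"] assms by (simp add: powr_minus)
  then show "AE w in lborel. norm ((1 + w\<^sup>2) powr (- b)) \<le> norm (inverse (1 + w\<^sup>2))" 
    by (intro AE_I2) (simp add: abs_of_nonneg)
qed simp

lemma integral_one_plus_square_powr_pos:
  assumes "b \<ge> 1"
  shows "(\<integral>w. (1 + (w::real)\<^sup>2) powr (- b) \<partial>lborel) > 0"
proof -
  have "(\<integral>w. indicator {0..1} (w::real) *\<^sub>R ((2::real) powr (- b)) \<partial>lborel) \<le> (\<integral>w. (1 + (w::real)\<^sup>2) powr (- b) \<partial>lborel)"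
  proof (rule integral_mono[OF _ integrable_one_plus_square_powr[OF assms]])
    fix w :: real
    have "2 powr (- b) \<le> (1 + w\<^sup>2) powr (- b)" if "0 \<le> w" "w \<le> 1"
      using that assms by (intro powr_mono2') (auto simp: power_le_one add_pos_nonneg)
    then show "indicator {0..1} w *\<^sub>R ((2::real) powr (- b)) \<le> (1 + w\<^sup>2) powr (- b)"
      by (auto simp: indicator_def)
  qed (auto intro!: integrable_real_mult_indicator)
  then show ?thesis
    by simp (smt (verit) powr_gt_zero)
qed

lemma integral_quadratic_powr:
  fixes A u y b :: real
  assumes "A > 0" "u > 0" "b \<ge> 1"
  shows "integrable lborel (\<lambda>w. (A + u * (w - y / u)\<^sup>2) powr (- b))"
    and "(\<integral>w. (A + u * (w - y / u)\<^sup>2) powr (- b) \<partial>lborel)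
      = u powr (- 1/2) * A powr (1/2 - b) * (\<integral>w. (1 + w\<^sup>2) powr (- b) \<partial>lborel)"
proof -
  \<comment> \<open>The substitution \<open>t + c * w = c * (w - y / u)\<close> turns the quadratic
    into \<open>A * (1 + (t + c * w)^2)\<close>; its Jacobian supplies the powers of
    \<open>u\<close> and \<open>A\<close>.\<close>
  define c where "c = sqrt (u / A)"
  define t where "t = - c * y / u"
  have c: "c > 0" "c\<^sup>2 = u / A" using assms by (auto simp: c_def)
  have "A + u * (w - y / u)\<^sup>2 = A * (1 + (t + c * w)\<^sup>2)" for w
  proof -
    have "t + c * w = c * (w - y / u)" by (simp add: t_def algebra_simps)
    then have "(t + c * w)\<^sup>2 = u / A * (w - y / u)\<^sup>2" using c(2) by (simp add: power_mult_distrib)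
    then show ?thesis using assms by (simp add: field_simps)
  qed
  then have eq: "(A + u * (w - y / u)\<^sup>2) powr (- b) = A powr (- b) * (1 + (t + c * w)\<^sup>2) powr (- b)" for w
    using assms by (simp add: powr_mult)
  show "integrable lborel (\<lambda>w. (A + u * (w - y / u)\<^sup>2) powr (- b))"
    unfolding eq using lborel_integrable_real_affine[OF integrable_one_plus_square_powr[OF \<open>b \<ge> 1\<close>], of c t] c
    by auto
  have "inverse c = u powr (- 1/2) * A powr (1/2)"
    using assms unfolding c_def by (simp add: powr_minus powr_half_sqrt real_sqrt_divide field_simps)
  moreover have "(\<integral>w. (1 + (t + c * w)\<^sup>2) powr (- b) \<partial>lborel) = inverse c * (\<integral>w. (1 + w\<^sup>2) powr (- b) \<partial>lborel)"
    using lborel_integral_real_affine[of c "\<lambda>w. (1 + w\<^sup>2) powr (- b)" t] c by simp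
  ultimately show "(\<integral>w. (A + u * (w - y / u)\<^sup>2) powr (- b) \<partial>lborel)
      = u powr (- 1/2) * A powr (1/2 - b) * (\<integral>w. (1 + w\<^sup>2) powr (- b) \<partial>lborel)"
    unfolding eq integral_mult_right_zero using powr_add[of A "1/2" "- b"] by simp
qed

text \<open>Completing the square in \<open>w\<close> turns \<open>v + w\<^sup>2 u - 2 w y\<close> into \<open>v - y\<^sup>2 / u\<close> plus a square, so
integrating out \<open>w\<close> produces one more square \<open>y\<^sup>2\<close> from a form that is linear in the point.
Each square costs a factor \<open>u\<^bsup>-1/2\<^esup>\<close>, whence the lower bound on \<open>a\<close>.\<close>

lemma diff_monotone_on_lorentz_powr:
  fixes u v :: "'a::real_normed_vector \<Rightarrow> real"
  assumes C: "open_convex_cone C"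
    and u: "bounded_linear u" "\<And>x. x \<in> C \<Longrightarrow> u x > 0"
    and "bounded_linear v" "\<And>z. z \<in> set zs \<Longrightarrow> bounded_linear z"
    and "\<And>x. x \<in> C \<Longrightarrow> (\<Sum>z\<leftarrow>zs. (z x)\<^sup>2) < u x * v x"
    and "a \<ge> real (length zs) / 2" "b \<ge> 0" "zs \<noteq> [] \<Longrightarrow> b \<ge> 1/2"
  shows "diff_monotone_on C (\<lambda>x. u x powr (- a) * (v x - (\<Sum>z\<leftarrow>zs. (z x)\<^sup>2) / u x) powr (- b))"
  using assms(4-)
proof (induction zs arbitrary: v a b)
  case Nil
  have "v x > 0" if "x \<in> C" for x
    using Nil.prems(3)[OF that] u(2)[OF that] by (simp add: zero_less_mult_iff)
  then show ?case
    using Nil.prems by (auto intro!: diff_monotone_on_mult diff_monotone_on_linear_powr C u)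
next
  case (Cons y zs)
  define S where "S x = (\<Sum>z\<leftarrow>zs. (z x)\<^sup>2)" for x
  \<comment> \<open>The integrand drops the square of \<open>y\<close> at the price of
    \<open>a - 1/2\<close>, \<open>b + 1/2\<close> and a new linear form in place of
    \<open>v\<close>.\<close>
  define g where "g w x = u x powr (- (a - 1/2)) * ((v x + w\<^sup>2 * u x - 2 * w * y x) - S x / u x) powr (- (b + 1/2))" for w x
  define K :: real where "K = (\<integral>w. (1 + w\<^sup>2) powr (- (b + 1/2)) \<partial>lborel)"
  have b: "b \<ge> 1/2" using Cons.prems by simp
  have K: "K > 0" unfolding K_def using b by (intro integral_one_plus_square_powr_pos) simp
  define A where "A x = v x - ((y x)\<^sup>2 + S x) / u x" for x
  have A: "A x > 0" if "x \<in> C" for x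
    using Cons.prems(3)[OF that] u(2)[OF that] by (simp add: A_def S_def field_simps)
  have g: "g w x = u x powr (- (a - 1/2)) * (A x + u x * (w - y x / u x)\<^sup>2) powr (- (b + 1/2))"
    if "x \<in> C" for w x
  proof -
    have "v x + w\<^sup>2 * u x - 2 * w * y x - S x / u x = A x + u x * (w - y x / u x)\<^sup>2"
      using u(2)[OF that] by (simp add: A_def field_simps power2_eq_square)
    then show ?thesis by (simp only: g_def)
  qed
  have int: "integrable lborel (\<lambda>w. g w x)" if "x \<in> C" for x
    using integral_quadratic_powr(1)[OF A[OF that] u(2)[OF that], of "b + 1/2" "y x"] b by (simp add: g[OF that])
  \<comment> \<open>The factor \<open>u powr (- 1/2)\<close> produced by the integral restores the
    exponent \<open>- a\<close>.\<close>
  have val: "(\<integral>w. g w x \<partial>lborel) = K * (u x powr (- a) * A x powr (- b))" if "x \<in> C" for x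
    using integral_quadratic_powr(2)[OF A[OF that] u(2)[OF that], of "b + 1/2" "y x"] b
    by (simp add: g[OF that] K_def powr_add[of "u x" "1/2 - a" "-1/2", simplified])
  have lin: "bounded_linear (\<lambda>x. v x + w\<^sup>2 * u x - 2 * w * y x)" for w
    using Cons.prems u by (intro bounded_linear_add bounded_linear_sub bounded_linear_const_mult) auto
  have dm: "diff_monotone_on C (g w)" for w
    unfolding g_def S_def
  proof (rule Cons.IH[OF lin])
    fix x assume x: "x \<in> C"
    have "(y x)\<^sup>2 + S x < u x * v x" using Cons.prems(3)[OF x] by (simp add: S_def)
    \<comment> \<open>This square is exactly the change in the margin when \<open>v\<close> is
      replaced and \<open>y\<close> is dropped.\<close>
    moreover have "0 \<le> (u x * w - y x)\<^sup>2" by simp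
    ultimately show "(\<Sum>z\<leftarrow>zs. (z x)\<^sup>2) < u x * (v x + w\<^sup>2 * u x - 2 * w * y x)"
      by (simp add: S_def power2_eq_square algebra_simps)
  qed (use Cons.prems b in auto)
  have "diff_monotone_on C (\<lambda>x. inverse K * (\<integral>w. g w x \<partial>lborel))"
    using K by (intro diff_monotone_on_cmult diff_monotone_on_integral[OF C int dm]) auto
  then show ?case
    by (rule iffD1[OF diff_monotone_on_cong[OF C], rotated]) (use K val in \<open>auto simp: A_def S_def field_simps\<close>)
qed

section \<open>Obstructions to complete monotonicity\<close>

text \<open>Writing \<open>x\<close> as three copies of \<open>x / 3\<close> gives the base point
  and both shifts room inside \<open>C\<close>; by openness the small perturbations
  \<open>h *\<^sub>R w i\<close> may then point in any direction.\<close>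

lemma diff_monotone_on_positive_definite_at:
  fixes f :: "'a::real_normed_vector \<Rightarrow> real"
  assumes C: "open_convex_cone C" and f: "diff_monotone_on C f" and x: "x \<in> C" and I: "finite I"
  shows "\<forall>\<^sub>F h in at_right 0. (\<Sum>i\<in>I. \<Sum>j\<in>I. c i * c j * f (x + h *\<^sub>R (w i + w j))) \<ge> 0"
proof -
  have x3: "(1/3) *\<^sub>R x \<in> C" using open_convex_cone_scale[OF C x] by simp
  have "\<forall>\<^sub>F h in at_right 0. (1/3) *\<^sub>R x + h *\<^sub>R w i \<in> C" for i
  proof -
    have "((\<lambda>h. (1/3) *\<^sub>R x + h *\<^sub>R w i) \<longlongrightarrow> (1/3) *\<^sub>R x + 0 *\<^sub>R w i) (at_right 0)"
      by (intro tendsto_intros)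
    then show ?thesis
      using x3 C by (intro topological_tendstoD) (auto simp: open_convex_cone_def)
  qed
  then have "\<forall>\<^sub>F h in at_right 0. \<forall>i\<in>I. (1/3) *\<^sub>R x + h *\<^sub>R w i \<in> C"
    using I by (simp add: eventually_ball_finite_distrib)
  then show ?thesis
  proof eventually_elim
    case (elim h)
    have eq: "(1/3) *\<^sub>R x + ((1/3) *\<^sub>R x + h *\<^sub>R w i) + ((1/3) *\<^sub>R x + h *\<^sub>R w j) = x + h *\<^sub>R (w i + w j)" for i j
    proof -
      have "x = (1/3) *\<^sub>R x + (1/3) *\<^sub>R x + (1/3) *\<^sub>R x" by (simp flip: scaleR_add_left)
      then show ?thesis by (simp add: scaleR_right_distrib)
    qed
    have "0 \<le> (\<Sum>i\<in>I. \<Sum>j\<in>I. c i * c j *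
        f ((1/3) *\<^sub>R x + ((1/3) *\<^sub>R x + h *\<^sub>R w i) + ((1/3) *\<^sub>R x + h *\<^sub>R w j)))"
      using elim by (intro diff_monotone_on_positive_definite[OF C f x3 I]) auto
    then show ?case by (simp only: eq)
  qed
qed

section \<open>Sign and orthogonality obstructions for powers of a quadratic form\<close>

locale symmetric_form =
  fixes B :: "'a::euclidean_space \<Rightarrow> 'a \<Rightarrow> real"
  assumes bil: "bilinear B" and sym: "B x y = B y x"
begin

lemmas form_simps = bilinear_ladd[OF bil] bilinear_radd[OF bil] bilinear_lmul[OF bil]
  bilinear_rmul[OF bil] bilinear_lsub[OF bil] bilinear_rsub[OF bil] bilinear_lneg[OF bil]
  bilinear_rneg[OF bil] bilinear_lzero[OF bil] bilinear_rzero[OF bil]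

lemma bounded_linear_form: "bounded_linear (\<lambda>x. B x y)"
  using bil by (simp add: bilinear_def linear_linear)

text \<open>The difference at \<open>x\<close> along \<open>x\<close> compares the powers of
  \<open>B x x\<close> and \<open>4 * B x x\<close>.\<close>

lemma diff_monotone_on_exponent_nonneg:
  assumes C: "open_convex_cone C" "C \<noteq> {}" and pos: "\<And>x. x \<in> C \<Longrightarrow> B x x > 0"
    and f: "diff_monotone_on C (\<lambda>x. B x x powr (- \<beta>))"
  shows "\<beta> \<ge> 0"
proof -
  obtain x where x: "x \<in> C" using C by blast
  have "0 \<le> shift_diff x (\<lambda>x. B x x powr (- \<beta>)) x"
    using f x by (intro diff_monotone_on_nonneg[OF diff_monotone_on_shift_diff])
  then have "(4 * B x x) powr (- \<beta>) \<le> B x x powr (- \<beta>)"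
    by (simp add: shift_diff_def form_simps)
  then show "\<beta> \<ge> 0"
    using powr_less_mono2[of "- \<beta>" "B x x" "4 * B x x"] pos[OF x] by fastforce
qed

lemma not_diff_monotone_on_orthogonal_pos:
  assumes C: "open_convex_cone C" and x: "x \<in> C" "B x x > 0"
    and v: "B x v = 0" "B v v > 0" and "\<beta> > 0"
  shows "\<not> diff_monotone_on C (\<lambda>x. B x x powr (- \<beta>))"
proof
  assume f: "diff_monotone_on C (\<lambda>x. B x x powr (- \<beta>))"
  \<comment> \<open>Weights \<open>1\<close> and \<open>- 1\<close> at \<open>v\<close> and
    \<open>- v\<close>: the diagonal terms sit at \<open>x\<close> shifted by \<open>2 * h\<close>
    times \<open>v\<close> or \<open>- v\<close>, the mixed ones at \<open>x\<close> itself.\<close>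
  define c w where "c b = (if b then 1 else - 1 :: real)" and "w b = (if b then v else - v)" for b
  have "\<forall>\<^sub>F h in at_right 0. (\<Sum>i\<in>UNIV. \<Sum>j\<in>UNIV. c i * c j *
      B (x + h *\<^sub>R (w i + w j)) (x + h *\<^sub>R (w i + w j)) powr (- \<beta>)) \<ge> 0"
    by (rule diff_monotone_on_positive_definite_at[OF C f x(1)]) simp
  moreover have "\<forall>\<^sub>F h in at_right 0. h > (0 :: real)" by (rule eventually_at_right_less)
  ultimately have "\<forall>\<^sub>F h in at_right (0 :: real). False"
  proof eventually_elim
    case (elim h)
    have "B x x powr (- \<beta>) \<le> (B x x + 4 * h\<^sup>2 * B v v) powr (- \<beta>)"
      using elim(1) v sym[of v x]
      by (simp add: UNIV_bool c_def w_def form_simps power2_eq_square algebra_simps)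
    moreover have "(B x x + 4 * h\<^sup>2 * B v v) powr (- \<beta>) < B x x powr (- \<beta>)"
      using elim(2) v x \<open>\<beta> > 0\<close> by (intro powr_less_mono2_neg) auto
    ultimately show ?case by simp
  qed
  then show False by simp
qed

end

text \<open>The limits are the values of \<open>\<partial>\<^sub>i\<^sup>2 \<partial>\<^sub>j\<^sup>2\<close> of the inverse power at the unit timelike vector, in
the order time-time, time-space, space-space with equal and with distinct directions.\<close>

lemma fourth_difference_limits:
  fixes b :: real and \<gamma> :: "real \<Rightarrow> real"
  assumes "b > 0" and \<gamma>: "\<gamma> = (\<lambda>s. if s = 0 then - 2 else 1)"
  shows "((\<lambda>h::real. (\<Sum>s\<in>{-1,0,1}. \<Sum>t\<in>{-1,0,1}. \<gamma> s * \<gamma> t * ((1 + h * (s + t))\<^sup>2) powr (- b)) / h ^ 4)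
      \<longlongrightarrow> 2 * b * (2 * b + 1) * (2 * b + 2) * (2 * b + 3)) (at_right 0)"
    and "((\<lambda>h::real. (\<Sum>s\<in>{-1,0,1}. \<Sum>t\<in>{-1,0,1}. \<gamma> s * \<gamma> t * ((1 + h * s)\<^sup>2 - h\<^sup>2 * t\<^sup>2) powr (- b)) / h ^ 4)
      \<longlongrightarrow> 2 * b * (2 * b + 2) * (2 * b + 3)) (at_right 0)"
    and "((\<lambda>h::real. (\<Sum>s\<in>{-1,0,1}. \<Sum>t\<in>{-1,0,1}. \<gamma> s * \<gamma> t * (1 - h\<^sup>2 * (s + t)\<^sup>2) powr (- b)) / h ^ 4)
      \<longlongrightarrow> 12 * b * (b + 1)) (at_right 0)"
    and "((\<lambda>h::real. (\<Sum>s\<in>{-1,0,1}. \<Sum>t\<in>{-1,0,1}. \<gamma> s * \<gamma> t * (1 - h\<^sup>2 * (s\<^sup>2 + t\<^sup>2)) powr (- b)) / h ^ 4)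
      \<longlongrightarrow> 4 * b * (b + 1)) (at_right 0)"
  using assms(1) unfolding \<gamma>
  by (simp_all, (real_asymp, simp add: algebra_simps power2_eq_square power3_eq_cube power4_eq_xxxx)+)


context symmetric_form
begin

text \<open>The finite difference analogue of \<open>\<box>\<^sup>2 (Q powr - \<beta>) \<ge> 0\<close>, where \<open>\<box>\<close> is the wave operator
of the span of \<open>e z\<close> and the \<open>e i\<close>.\<close>

lemma diff_monotone_on_wave_operator:
  assumes C: "open_convex_cone C" and f: "diff_monotone_on C (\<lambda>x. B x x powr (- \<beta>))" and "\<beta> > 0"
    and N: "finite N" "z \<notin> N" and z: "e z \<in> C" "B (e z) (e z) = 1"
    and ez: "\<And>i. i \<in> N \<Longrightarrow> B (e z) (e i) = 0"
    and e: "\<And>i j. i \<in> N \<Longrightarrow> j \<in> N \<Longrightarrow> B (e i) (e j) = (if i = j then - 1 else 0)"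
  shows "(real (card N) - 2 * \<beta> - 1) * (real (card N) - 2 * \<beta> - 3) \<ge> 0"
proof -
  \<comment> \<open>Weights \<open>1, -2, 1\<close> of the central second difference;
    \<open>\<epsilon>\<close> below holds the signs of the wave operator.\<close>
  define \<gamma> :: "real \<Rightarrow> real" where "\<gamma> = (\<lambda>s. if s = 0 then - 2 else 1)"
  define \<epsilon> :: "_ \<Rightarrow> real" where "\<epsilon> i = (if i = z then 1 else - 1)" for i
  \<comment> \<open>After division by \<open>h ^ 4\<close>, \<open>T i j h\<close> approximates the
    second derivatives along \<open>e i\<close> and \<open>e j\<close> applied in succession at
    \<open>e z\<close>; \<open>L i j\<close> is the limit.\<close>
  define T where "T i j h = (\<Sum>s\<in>{-1,0,1}. \<Sum>t\<in>{-1,0,1}. \<gamma> s * \<gamma> t *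
    B (e z + h *\<^sub>R (s *\<^sub>R e i + t *\<^sub>R e j)) (e z + h *\<^sub>R (s *\<^sub>R e i + t *\<^sub>R e j)) powr (- \<beta>))" for i j and h :: real
  define L where "L i j = (if i = z \<and> j = z then 2 * \<beta> * (2 * \<beta> + 1) * (2 * \<beta> + 2) * (2 * \<beta> + 3)
    else if i = z \<or> j = z then 2 * \<beta> * (2 * \<beta> + 2) * (2 * \<beta> + 3)
    else if i = j then 12 * \<beta> * (\<beta> + 1) else 4 * \<beta> * (\<beta> + 1))" for i j
  let ?J = "insert z N"
  note lims = fourth_difference_limits[OF \<open>\<beta> > 0\<close> \<gamma>_def]
  have ez': "B (e i) (e z) = 0" if "i \<in> N" for i using ez[OF that] sym by simp
  have T: "((\<lambda>h. T i j h / h ^ 4) \<longlongrightarrow> L i j) (at_right 0)" if "i \<in> ?J" "j \<in> ?J" for i j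
  proof -
    have "B (e z + h *\<^sub>R (s *\<^sub>R e i + t *\<^sub>R e j)) (e z + h *\<^sub>R (s *\<^sub>R e i + t *\<^sub>R e j)) =
      (if i = z \<and> j = z then (1 + h * (s + t))\<^sup>2 else if i = z then (1 + h * s)\<^sup>2 - h\<^sup>2 * t\<^sup>2
       else if j = z then (1 + h * t)\<^sup>2 - h\<^sup>2 * s\<^sup>2
       else if i = j then 1 - h\<^sup>2 * (s + t)\<^sup>2 else 1 - h\<^sup>2 * (s\<^sup>2 + t\<^sup>2))" for s t h
      using that z(2) ez ez' e N(2) by (auto simp: form_simps power2_eq_square algebra_simps)
    then have T': "T i j h = (\<Sum>s\<in>{-1,0,1}. \<Sum>t\<in>{-1,0,1}. \<gamma> s * \<gamma> t *
      (if i = z \<and> j = z then (1 + h * (s + t))\<^sup>2 else if i = z then (1 + h * s)\<^sup>2 - h\<^sup>2 * t\<^sup>2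
       else if j = z then (1 + h * t)\<^sup>2 - h\<^sup>2 * s\<^sup>2
       else if i = j then 1 - h\<^sup>2 * (s + t)\<^sup>2 else 1 - h\<^sup>2 * (s\<^sup>2 + t\<^sup>2)) powr (- \<beta>))" for h
      unfolding T_def by (simp only:)
    consider "i = z" "j = z" | "i = z" "j \<noteq> z" | "i \<noteq> z" "j = z" | "i \<noteq> z" "j \<noteq> z" "i = j"
      | "i \<noteq> z" "j \<noteq> z" "i \<noteq> j" by blast
    then show ?thesis
    proof cases
      case 1 then show ?thesis using lims(1) unfolding T' L_def by (simp only: simp_thms if_True if_False)
    next
      case 2 then show ?thesis using lims(2) unfolding T' L_def by (simp only: simp_thms if_True if_False)
    next
      \<comment> \<open>The mirror image of the previous case, obtained by exchanging the two
        sums.\<close>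
      case 3 then show ?thesis
        using lims(2) unfolding T' L_def
        by (subst sum.swap) (simp only: simp_thms if_True if_False mult.commute[of "\<gamma> _" "\<gamma> _"])
    next
      case 4 then show ?thesis using lims(3) unfolding T' L_def by (simp only: simp_thms if_True if_False)
    next
      case 5 then show ?thesis using lims(4) unfolding T' L_def by (simp only: simp_thms if_True if_False)
    qed
  qed
  \<comment> \<open>Positive definiteness with nodes \<open>s *\<^sub>R e i\<close> and weights
    \<open>\<epsilon> i * \<gamma> s\<close>, which discretise the wave operator.\<close>
  have "\<forall>\<^sub>F h in at_right 0. (\<Sum>p\<in>?J \<times> {-1,0,1}. \<Sum>q\<in>?J \<times> {-1,0,1}.
      (\<epsilon> (fst p) * \<gamma> (snd p)) * (\<epsilon> (fst q) * \<gamma> (snd q)) *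
      B (e z + h *\<^sub>R (snd p *\<^sub>R e (fst p) + snd q *\<^sub>R e (fst q)))
        (e z + h *\<^sub>R (snd p *\<^sub>R e (fst p) + snd q *\<^sub>R e (fst q))) powr (- \<beta>)) \<ge> 0"
    using N by (intro diff_monotone_on_positive_definite_at[OF C f z(1)]) auto
  moreover have "\<forall>\<^sub>F h in at_right 0. h > (0 :: real)" by (rule eventually_at_right_less)
  ultimately have ev: "\<forall>\<^sub>F h in at_right 0. (\<Sum>i\<in>?J. \<Sum>j\<in>?J. \<epsilon> i * \<epsilon> j * (T i j h / h ^ 4)) \<ge> 0"
  proof eventually_elim
    case (elim h)
    have "(\<Sum>p\<in>?J \<times> {-1,0,1}. \<Sum>q\<in>?J \<times> {-1,0,1}.
      (\<epsilon> (fst p) * \<gamma> (snd p)) * (\<epsilon> (fst q) * \<gamma> (snd q)) *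
      B (e z + h *\<^sub>R (snd p *\<^sub>R e (fst p) + snd q *\<^sub>R e (fst q)))
        (e z + h *\<^sub>R (snd p *\<^sub>R e (fst p) + snd q *\<^sub>R e (fst q))) powr (- \<beta>))
      = (\<Sum>i\<in>?J. \<Sum>s\<in>{-1,0,1}. \<Sum>j\<in>?J. \<Sum>t\<in>{-1,0,1}. \<epsilon> i * \<epsilon> j * (\<gamma> s * \<gamma> t *
      B (e z + h *\<^sub>R (s *\<^sub>R e i + t *\<^sub>R e j)) (e z + h *\<^sub>R (s *\<^sub>R e i + t *\<^sub>R e j)) powr (- \<beta>)))"
      unfolding sum.cartesian_product' by (simp only: fst_conv snd_conv mult_ac)
    also have "\<dots> = (\<Sum>i\<in>?J. \<Sum>j\<in>?J. \<epsilon> i * \<epsilon> j * T i j h)"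
      unfolding T_def sum_distrib_left by (intro sum.cong refl sum.swap)
    also have "\<dots> = h ^ 4 * (\<Sum>i\<in>?J. \<Sum>j\<in>?J. \<epsilon> i * \<epsilon> j * (T i j h / h ^ 4))"
      using elim(2) by (simp only: sum_distrib_left) (simp add: field_simps)
    finally show ?case using elim by (simp add: zero_le_mult_iff)
  qed
  have "((\<lambda>h. \<Sum>i\<in>?J. \<Sum>j\<in>?J. \<epsilon> i * \<epsilon> j * (T i j h / h ^ 4)) \<longlongrightarrow> (\<Sum>i\<in>?J. \<Sum>j\<in>?J. \<epsilon> i * \<epsilon> j * L i j)) (at_right 0)"
    by (intro tendsto_sum tendsto_mult_left T)
  from tendsto_lowerbound[OF this ev] have "0 \<le> (\<Sum>i\<in>?J. \<Sum>j\<in>?J. \<epsilon> i * \<epsilon> j * L i j)" by simp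
  also have "(\<Sum>i\<in>?J. \<Sum>j\<in>?J. \<epsilon> i * \<epsilon> j * L i j) =
      L z z - (\<Sum>j\<in>N. L z j) - (\<Sum>i\<in>N. L i z) + (\<Sum>i\<in>N. \<Sum>j\<in>N. L i j)"
  proof -
    have \<epsilon>: "\<epsilon> z = 1" "\<And>i. i \<in> N \<Longrightarrow> \<epsilon> i = - 1" using N(2) by (auto simp: \<epsilon>_def)
    show ?thesis using N by (simp add: \<epsilon> sum.distrib sum_negf sum_subtractf)
  qed
  also have "(\<Sum>j\<in>N. L z j) = real (card N) * (2 * \<beta> * (2 * \<beta> + 2) * (2 * \<beta> + 3))"
  proof -
    have "(\<Sum>j\<in>N. L z j) = (\<Sum>j\<in>N. 2 * \<beta> * (2 * \<beta> + 2) * (2 * \<beta> + 3))"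
      using N(2) by (intro sum.cong) (auto simp: L_def)
    then show ?thesis by simp
  qed
  also have "(\<Sum>i\<in>N. L i z) = real (card N) * (2 * \<beta> * (2 * \<beta> + 2) * (2 * \<beta> + 3))"
  proof -
    have "(\<Sum>j\<in>N. L j z) = (\<Sum>j\<in>N. 2 * \<beta> * (2 * \<beta> + 2) * (2 * \<beta> + 3))"
      using N(2) by (intro sum.cong) (auto simp: L_def)
    then show ?thesis by simp
  qed
  also have "(\<Sum>i\<in>N. \<Sum>j\<in>N. L i j) =
      real (card N) * (8 * \<beta> * (\<beta> + 1)) + real (card N) * real (card N) * (4 * \<beta> * (\<beta> + 1))"
  proof -
    \<comment> \<open>A diagonal entry \<open>12 * \<beta> * (\<beta> + 1)\<close> is split into the
      common off-diagonal value and an excess of \<open>8 * \<beta> * (\<beta> + 1)\<close>.\<close>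
    have "(\<Sum>i\<in>N. \<Sum>j\<in>N. L i j) = (\<Sum>i\<in>N. \<Sum>j\<in>N. (if i = j then 8 * \<beta> * (\<beta> + 1) else 0) + 4 * \<beta> * (\<beta> + 1))"
      using N(2) by (intro sum.cong) (auto simp: L_def)
    then show ?thesis using N(1) by (simp add: sum.distrib distrib_left)
  qed
  also have "L z z = 2 * \<beta> * (2 * \<beta> + 1) * (2 * \<beta> + 2) * (2 * \<beta> + 3)" by (simp add: L_def)
  finally have "0 \<le> 4 * \<beta> * (\<beta> + 1) * ((real (card N) - 2 * \<beta> - 1) * (real (card N) - 2 * \<beta> - 3))"
    by (simp add: algebra_simps)
  moreover have "0 < 4 * \<beta> * (\<beta> + 1)" using \<open>\<beta> > 0\<close> by simp
  ultimately show ?thesis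
    by (metis mult_left_le_imp_le mult_zero_right)
qed

text \<open>Restricting to a suitable number of negative directions makes the two factors of the
  wave operator inequality differ in sign.\<close>

lemma not_diff_monotone_on_small_exponent:
  assumes C: "open_convex_cone C" and "0 < \<beta>" "\<beta> < (real (card N) - 1) / 2"
    and N: "finite N" "z \<notin> N" and z: "e z \<in> C" "B (e z) (e z) = 1"
    and ez: "\<And>i. i \<in> N \<Longrightarrow> B (e z) (e i) = 0"
    and e: "\<And>i j. i \<in> N \<Longrightarrow> j \<in> N \<Longrightarrow> B (e i) (e j) = (if i = j then - 1 else 0)"
  shows "\<not> diff_monotone_on C (\<lambda>x. B x x powr (- \<beta>))"
proof
  assume f: "diff_monotone_on C (\<lambda>x. B x x powr (- \<beta>))"
  \<comment> \<open>The least integer strictly above \<open>2 * \<beta> + 1\<close>; it is at most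
    \<open>2 * \<beta> + 2\<close>, which puts it below \<open>2 * \<beta> + 3\<close>.\<close>
  define m where "m = nat \<lfloor>2 * \<beta> + 1\<rfloor> + 1"
  have m: "2 * \<beta> + 1 < real m" "real m \<le> 2 * \<beta> + 2" using \<open>0 < \<beta>\<close> unfolding m_def by linarith+
  then have "real m < real (card N) + 1" using assms(3) by (simp add: field_simps)
  then have "m \<le> card N" by linarith
  then obtain M where M: "M \<subseteq> N" "card M = m" "finite M" using obtain_subset_with_card_n by metis
  have "0 \<le> (real (card M) - 2 * \<beta> - 1) * (real (card M) - 2 * \<beta> - 3)"
    using M N by (intro diff_monotone_on_wave_operator[where z = z and e = e, OF C f \<open>0 < \<beta>\<close>] z ez e)
      (auto simp: subset_iff)
  moreover have "(real (card M) - 2 * \<beta> - 1) * (real (card M) - 2 * \<beta> - 3) < 0"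
    using m M by (intro mult_pos_neg) auto
  ultimately show False by simp
qed

end

section \<open>Diagonalisation\<close>

text \<open>A maximiser of the form on the unit sphere of \<open>W\<close> is an eigenvector
  relative to \<open>W\<close>: the first variation in every direction \<open>y\<close>
  vanishes.\<close>

lemma symmetric_form_maximizer:
  fixes B :: "'a::euclidean_space \<Rightarrow> 'a \<Rightarrow> real"
  assumes B: "bilinear B" and sym: "\<And>x y. B x y = B y x"
    and W: "subspace W" "W \<noteq> {0}"
  obtains e l where "e \<in> W" "norm e = 1" "\<And>y. y \<in> W \<Longrightarrow> B e y = l * inner e y"
proof -
  let ?S = "W \<inter> sphere 0 1"
  obtain y where y: "y \<in> W" "y \<noteq> 0" using W subspace_0[OF W(1)] by auto
  have "(1 / norm y) *\<^sub>R y \<in> ?S" using y W by (auto intro: subspace_scale)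
  then have ne: "?S \<noteq> {}" by blast
  have bb: "bounded_bilinear B" using B by (simp add: bilinear_conv_bounded_bilinear)
  have cpt: "compact ?S" by (intro closed_Int_compact closed_subspace W compact_sphere)
  have cont: "continuous_on ?S (\<lambda>x. B x x)"
    by (intro bounded_bilinear.continuous_on[OF bb] continuous_on_id)
  obtain e where e: "e \<in> ?S" "\<And>x. x \<in> ?S \<Longrightarrow> B x x \<le> B e e"
    using continuous_attains_sup[OF cpt ne cont] by blast
  note simps = bilinear_ladd[OF B] bilinear_radd[OF B] bilinear_lmul[OF B] bilinear_rmul[OF B]
    bilinear_lsub[OF B] bilinear_rsub[OF B] bilinear_lzero[OF B] bilinear_rzero[OF B]
  have ee: "inner e e = 1" using e by (simp add: dot_square_norm)
  have max: "B x x \<le> B e e * inner x x" if "x \<in> W" for x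
  proof (cases "x = 0")
    case False
    then have "(1 / norm x) *\<^sub>R x \<in> ?S" using that W by (auto intro: subspace_scale)
    from e(2)[OF this] False show ?thesis by (simp add: simps field_simps dot_square_norm power2_eq_square)
  qed (simp add: simps)
  have eq: "B e y = B e e * inner e y" if y: "y \<in> W" for y
  proof -
    define d where "d = B e y - B e e * inner e y"
    define r where "r = B e e * inner y y - B y y"
    have "2 * t * d \<le> t\<^sup>2 * r" for t
    proof -
      have "e + t *\<^sub>R y \<in> W" using e y W by (auto intro: subspace_add subspace_scale)
      from max[OF this] show ?thesis
        by (simp add: simps inner_add inner_commute[of y e] sym[of y e] ee d_def r_def algebra_simps power2_eq_square)
    qed
    \<comment> \<open>This step size is small enough for the linear term to dominate, forcing
      \<open>d = 0\<close>; the summand 1 keeps the denominator positive.\<close>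
    from this[of "d / (\<bar>r\<bar> + 1)"]
    have "2 * (d\<^sup>2 / (\<bar>r\<bar> + 1)) \<le> (d / (\<bar>r\<bar> + 1))\<^sup>2 * r"
      by (simp add: power2_eq_square)
    also have "\<dots> \<le> (d / (\<bar>r\<bar> + 1))\<^sup>2 * (\<bar>r\<bar> + 1)" by (intro mult_left_mono) auto
    also have "\<dots> = d\<^sup>2 / (\<bar>r\<bar> + 1)" by (simp add: power2_eq_square)
    finally have "d\<^sup>2 / (\<bar>r\<bar> + 1) \<le> 0" by simp
    then have "d\<^sup>2 \<le> 0" using divide_le_0_iff[of "d\<^sup>2" "\<bar>r\<bar> + 1"] by auto
    then have "d = 0" by simp
    then show ?thesis by (simp add: d_def)
  qed
  show thesis using e(1) by (intro that[of e "B e e"] eq) auto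
qed

text \<open>The spectral theorem, with eigenvectors found one by one in the orthogonal complement of
  the earlier ones.\<close>

lemma symmetric_form_orthonormal_eigenbasis:
  fixes B :: "'a::euclidean_space \<Rightarrow> 'a \<Rightarrow> real"
  assumes B: "bilinear B" and sym: "\<And>x y. B x y = B y x"
  shows "k \<le> DIM('a) \<Longrightarrow> \<exists>e l. (\<forall>i<k. \<forall>j<k. inner (e i) (e j) = (if i = j then 1 else 0)) \<and>
    (\<forall>i<k. \<forall>y. B (e i) y = l i * inner (e i) (y::'a))"
proof (induction k)
  case (Suc k)
  then obtain e l where "\<forall>i<k. \<forall>j<k. inner (e i) (e j) = (if i = j then 1 else 0)"
    "\<forall>i<k. \<forall>y. B (e i) y = l i * inner (e i) y" by auto
  then have e: "\<And>i j. i < k \<Longrightarrow> j < k \<Longrightarrow> inner (e i) (e j) = (if i = j then 1 else 0)"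
    and l: "\<And>i y. i < k \<Longrightarrow> B (e i) y = l i * inner (e i) y" by blast+
  define W where "W = {y. \<forall>i<k. inner (e i) y = 0}"
  have W: "subspace W" by (auto simp: W_def subspace_def inner_add)
  have "dim (e ` {..<k}) < DIM('a)"
    using dim_le_card[of "e ` {..<k}" "e ` {..<k}"] card_image_le[of "{..<k}" e] Suc.prems
    by (simp add: span_superset)
  from orthogonal_to_subspace_exists[OF this]
  obtain x where "x \<noteq> 0" "\<And>y. y \<in> span (e ` {..<k}) \<Longrightarrow> Linear_Algebra.orthogonal x y" by blast
  moreover from this have "x \<in> W"
    by (auto simp: W_def Linear_Algebra.orthogonal_def inner_commute[of _ x] span_base)
  ultimately have "W \<noteq> {0}" by auto
  obtain f m where f: "f \<in> W" "norm f = 1" "\<And>y. y \<in> W \<Longrightarrow> B f y = m * inner f y"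
    using symmetric_form_maximizer[OF B sym W \<open>W \<noteq> {0}\<close>] by blast
  have fe: "inner (e i) f = 0" "inner f (e i) = 0" if "i < k" for i
    using f(1) that by (auto simp: W_def inner_commute)
  have ff: "inner f f = 1" using f by (simp add: dot_square_norm)
  \<comment> \<open>So far \<open>f\<close> is an eigenvector only against \<open>W\<close>. The
    remaining component of \<open>y\<close> lies in the span of the earlier \<open>e i\<close>, on
    which both sides vanish.\<close>
  have Bf: "B f y = m * inner f y" for y
  proof -
    define y' where "y' = y - (\<Sum>i<k. inner (e i) y *\<^sub>R e i)"
    have "inner (e j) y' = 0" if j: "j < k" for j
    proof -
      have "(\<Sum>i<k. inner (e i) y * inner (e j) (e i)) = (\<Sum>i<k. if i = j then inner (e j) y else 0)"
        using j by (intro sum.cong) (auto simp: e)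
      then show ?thesis using j by (simp add: y'_def inner_diff_right inner_sum_right)
    qed
    then have "y' \<in> W" by (simp add: W_def)
    have "B f (\<Sum>i<k. inner (e i) y *\<^sub>R e i) = (\<Sum>i<k. inner (e i) y * B f (e i))"
      using B by (simp add: linear_sum linear_scale bilinear_def)
    also have "\<dots> = 0"
    proof (intro sum.neutral ballI)
      show "inner (e i) y * B f (e i) = 0" if "i \<in> {..<k}" for i
        using that l[of i f] fe(1)[of i] sym[of f "e i"] by simp
    qed
    finally have "B f y = B f y'" by (simp add: y'_def bilinear_rsub[OF B])
    also have "\<dots> = m * inner f y'" by (rule f(3)[OF \<open>y' \<in> W\<close>])
    also have "inner f y' = inner f y" using fe by (simp add: y'_def inner_diff_right inner_sum_right)
    finally show ?thesis .
  qed
  have "inner ((e(k := f)) i) ((e(k := f)) j) = (if i = j then 1 else 0)" if "i < Suc k" "j < Suc k" for i j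
    using that e fe ff by (auto simp: less_Suc_eq)
  moreover have "B ((e(k := f)) i) y = (l(k := m)) i * inner ((e(k := f)) i) y" if "i < Suc k" for i y
    using that l Bf by (auto simp: less_Suc_eq)
  ultimately show ?case by blast
qed auto


text \<open>The map \<open>\<phi>\<close> sends an orthonormal basis to \<open>bs\<close>, so the
  Gram matrix represents the pulled back form \<open>B'\<close> in orthonormal coordinates. An
  eigenbasis of \<open>B'\<close> diagonalises it by similarity, and its image under
  \<open>\<phi>\<close> is orthogonal for \<open>B\<close>.\<close>

lemma gram_matrix_diagonalisation:
  fixes B :: "'a::euclidean_space \<Rightarrow> 'a \<Rightarrow> real"
  assumes B: "bilinear B" and sym: "\<And>x y. B x y = B y x" and bs: "is_basis_list bs"
  obtains d l where "\<And>i j. i < DIM('a) \<Longrightarrow> j < DIM('a) \<Longrightarrow> B (d i) (d j) = (if i = j then l i else 0)"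
    and "\<And>y. \<exists>c. y = (\<Sum>i<DIM('a). c i *\<^sub>R d i)"
    and "eigenvalues_mset (gram_matrix B bs) = image_mset l (mset_set {..<DIM('a)})"
proof -
  define n where "n = DIM('a)"
  have len: "length bs = n"
    using bs distinct_card[of bs] basis_card_eq_dim[of "set bs" UNIV]
    by (simp add: is_basis_list_def n_def dim_UNIV)
  obtain xs :: "'a list" where xs: "distinct xs" "set xs = Basis"
    using finite_distinct_list[OF finite_Basis] by blast
  have lxs: "length xs = n" using distinct_card[OF xs(1)] xs(2) by (simp add: n_def)
  have xs_inner: "inner (xs ! i) (xs ! j) = (if i = j then 1 else 0)" if "i < n" "j < n" for i j
    using that xs lxs nth_mem[of i xs] nth_mem[of j xs] by (simp add: inner_Basis nth_eq_iff_index_eq)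
  have sum_xs: "(\<Sum>b\<in>Basis. h b) = (\<Sum>i<n. h (xs ! i))" for h :: "'a \<Rightarrow> 'b::comm_monoid_add"
    using sum.reindex_bij_betw[OF bij_betw_nth[OF xs(1) _ xs(2)[symmetric], of "{..<n}"], of h] lxs by simp
  define \<phi> where "\<phi> y = (\<Sum>i<n. inner y (xs ! i) *\<^sub>R bs ! i)" for y
  have lin: "linear \<phi>"
    by (rule linearI) (simp_all add: \<phi>_def inner_add_left scaleR_add_left sum.distrib scaleR_sum_right)
  have \<phi>_xs: "\<phi> (xs ! i) = bs ! i" if "i < n" for i
  proof -
    have "\<phi> (xs ! i) = (\<Sum>j<n. if j = i then bs ! i else 0)"
      unfolding \<phi>_def using that by (intro sum.cong) (auto simp: xs_inner)
    then show ?thesis using that by simp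
  qed
  have surj: "surj \<phi>"
  proof -
    have "set bs \<subseteq> range \<phi>"
    proof
      fix b assume "b \<in> set bs"
      then obtain i where "i < n" "b = bs ! i" using len by (auto simp: in_set_conv_nth)
      then have "b = \<phi> (xs ! i)" by (simp add: \<phi>_xs)
      then show "b \<in> range \<phi>" by blast
    qed
    moreover have "subspace (range \<phi>)" using lin by (rule linear_subspace_image) (rule subspace_UNIV)
    ultimately have "span (set bs) \<subseteq> range \<phi>" by (rule span_minimal)
    then show ?thesis using bs by (auto simp: is_basis_list_def)
  qed
  define B' where "B' x y = B (\<phi> x) (\<phi> y)" for x y
  have B': "bilinear B'"
    unfolding bilinear_def B'_def using B lin
    by (auto simp: bilinear_def intro: linear_compose[OF lin, unfolded o_def])
  have B'_sym: "B' x y = B' y x" for x y unfolding B'_def by (rule sym)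
  obtain e l where e: "\<forall>i<n. \<forall>j<n. inner (e i) (e j) = (if i = j then 1 else 0)"
    and l: "\<forall>i<n. \<forall>y. B' (e i) y = l i * inner (e i) (y::'a)"
    using symmetric_form_orthonormal_eigenbasis[OF B' B'_sym, of n] unfolding n_def by blast
  have e_exp: "y = (\<Sum>i<n. inner (e i) y *\<^sub>R e i)" for y
  proof -
    have inj: "inj_on e {..<n}"
    proof (rule inj_onI)
      fix i j assume *: "i \<in> {..<n}" "j \<in> {..<n}" "e i = e j"
      have "inner (e i) (e i) = 1" "inner (e i) (e j) = (if i = j then 1 else 0)" using e *(1,2) by auto
      then show "i = j" unfolding *(3) by (simp split: if_splits)
    qed
    have orth: "pairwise Linear_Algebra.orthogonal (e ` {..<n})"
      using e by (auto simp: pairwise_def Linear_Algebra.orthogonal_def)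
    have "e i \<noteq> 0" if "i < n" for i
    proof -
      have "inner (e i) (e i) = 1" using e that by simp
      then show ?thesis by auto
    qed
    then have "0 \<notin> e ` {..<n}" by force
    then have "independent (e ` {..<n})" by (rule pairwise_orthogonal_independent[OF orth])
    moreover have "card (e ` {..<n}) = DIM('a)" using card_image[OF inj] by (simp add: n_def)
    ultimately have "UNIV \<subseteq> span (e ` {..<n})"
      by (intro card_ge_dim_independent) (auto simp: dim_UNIV)
    then have "y \<in> span (e ` {..<n})" by blast
    then obtain u where u: "y = (\<Sum>v\<in>e ` {..<n}. u v *\<^sub>R v)" by (auto simp: span_finite)
    then have y: "y = (\<Sum>i<n. u (e i) *\<^sub>R e i)" by (simp add: sum.reindex[OF inj] o_def)
    have "inner (e j) y = u (e j)" if "j < n" for j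
    proof -
      have "inner (e j) y = (\<Sum>i<n. if i = j then u (e j) else 0)"
        unfolding y inner_sum_right using that e by (intro sum.cong) auto
      then show ?thesis using that by simp
    qed
    then have "(\<Sum>i<n. inner (e i) y *\<^sub>R e i) = (\<Sum>i<n. u (e i) *\<^sub>R e i)" by simp
    with y show ?thesis by simp
  qed
  define G where "G = gram_matrix B bs"
  \<comment> \<open>The columns of \<open>P\<close> are the coordinates of the eigenvectors;
    \<open>P'\<close> is the transpose and hence the inverse.\<close>
  define P where "P = Matrix.mat n n (\<lambda>(i, j). inner (xs ! i) (e j))"
  define P' where "P' = Matrix.mat n n (\<lambda>(i, j). inner (xs ! j) (e i))"
  define D where "D = Matrix.mat n n (\<lambda>(i, j). if i = j then l i else 0)"
  have carr: "G \<in> carrier_mat n n" "P \<in> carrier_mat n n" "P' \<in> carrier_mat n n" "D \<in> carrier_mat n n"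
    by (auto simp: G_def P_def P'_def D_def gram_matrix_def len)
  have inner_xs: "(\<Sum>k<n. inner (xs ! k) x * inner (xs ! k) y) = inner x y" for x y
    using sum_xs[of "\<lambda>b. inner b x * inner b y"] euclidean_inner[of x y] by (simp add: inner_commute)
  have P'P: "P' * P = 1\<^sub>m n"
  proof (rule eq_matI)
    fix i j assume "i < dim_row (1\<^sub>m n)" "j < dim_col (1\<^sub>m n)"
    then show "(P' * P) $$ (i, j) = 1\<^sub>m n $$ (i, j)"
      using e by (simp add: P_def P'_def scalar_prod_def inner_xs flip: atLeast0LessThan)
        (simp add: atLeast0LessThan inner_xs)
  qed (auto simp: P_def P'_def)
  then have PP': "P * P' = 1\<^sub>m n" using mat_mult_left_right_inverse carr by blast
  have GP: "G * P = P * D"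
  proof (rule eq_matI)
    fix i j assume ij: "i < dim_row (P * D)" "j < dim_col (P * D)"
    then have ij: "i < n" "j < n" by (auto simp: P_def D_def)
    have "(G * P) $$ (i, j) = (\<Sum>k<n. B (bs ! i) (bs ! k) * inner (xs ! k) (e j))"
      using ij len by (simp add: G_def P_def gram_matrix_def scalar_prod_def atLeast0LessThan)
    also have "\<dots> = B' (xs ! i) (\<Sum>k<n. inner (xs ! k) (e j) *\<^sub>R xs ! k)"
      using ij B' unfolding bilinear_def by (simp add: linear_sum linear_scale) (simp add: B'_def \<phi>_xs mult.commute)
    also have "(\<Sum>k<n. inner (xs ! k) (e j) *\<^sub>R xs ! k) = e j"
      using sum_xs[of "\<lambda>b. inner b (e j) *\<^sub>R b"] euclidean_representation[of "e j"] by (simp add: inner_commute)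
    also have "B' (xs ! i) (e j) = B' (e j) (xs ! i)" unfolding B'_def by (rule sym)
    also have "\<dots> = l j * inner (xs ! i) (e j)" using l ij by (simp add: inner_commute)
    also have "\<dots> = (P * D) $$ (i, j)"
      using ij by (simp add: P_def D_def scalar_prod_def if_distrib[of "\<lambda>x. _ * x"] sum.delta cong: if_cong)
    finally show "(G * P) $$ (i, j) = (P * D) $$ (i, j)" .
  qed (auto simp: P_def D_def G_def gram_matrix_def len)
  have "G = G * (P * P')" using carr by (simp add: PP')
  also have "\<dots> = G * P * P'" by (rule assoc_mult_mat[OF carr(1,2,3), symmetric])
  also have "\<dots> = P * D * P'" by (simp only: GP)
  finally have "similar_mat_wit G D P P'"
    by (rule similar_mat_witI[OF PP' P'P _ carr(1,4,2,3)])
  then have "char_poly G = char_poly D" by (intro char_poly_similar) (auto simp: similar_mat_def)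
  also have "\<dots> = (\<Prod>a\<leftarrow>diag_mat D. [:- a, 1:])"
    by (rule char_poly_upper_triangular[OF carr(4)]) (auto simp: D_def)
  also have "diag_mat D = map l [0..<n]" by (simp add: diag_mat_def D_def)
  finally have "eigenvalues_mset G = proots (\<Prod>a\<leftarrow>map l [0..<n]. [:- a, 1:])"
    by (simp add: eigenvalues_mset_def)
  also have "proots (\<Prod>a\<leftarrow>as. [:- a, 1:]) = mset as" for as :: "real list"
  proof (induction as)
    case (Cons a as)
    have "(\<Prod>a\<leftarrow>as. [:- a, 1:]) \<noteq> 0" by (auto simp: prod_list_zero_iff)
    then have "proots ([:- a, 1:] * (\<Prod>a\<leftarrow>as. [:- a, 1:])) = proots [:- a, 1:] + proots (\<Prod>a\<leftarrow>as. [:- a, 1:])"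
      by (intro proots_mult) auto
    then show ?case using Cons by (simp del: mult_pCons_left)
  qed simp
  also have "mset (map l [0..<n]) = image_mset l (mset_set {..<n})"
    by (simp add: mset_upt atLeast0LessThan)
  finally have ev: "eigenvalues_mset (gram_matrix B bs) = image_mset l (mset_set {..<n})"
    by (simp only: G_def)
  show thesis
  proof (rule that[of "\<lambda>i. \<phi> (e i)" l, folded n_def])
    show "B (\<phi> (e i)) (\<phi> (e j)) = (if i = j then l i else 0)" if "i < n" "j < n" for i j
      using that l e by (simp add: B'_def[symmetric])
    fix y
    obtain x where "y = \<phi> x" using surj by blast
    moreover have "\<phi> x = (\<Sum>i<n. inner (e i) x *\<^sub>R \<phi> (e i))"
      using arg_cong[OF e_exp[of x], of \<phi>] lin by (simp add: linear_sum linear_scale)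
    ultimately show "\<exists>c. y = (\<Sum>i<n. c i *\<^sub>R \<phi> (e i))"
      by (intro exI[of _ "\<lambda>i. inner (e i) x"]) simp
  qed (rule ev)
qed


text \<open>Dividing \<open>d i\<close> by the square root of \<open>\<bar>l i\<bar>\<close>
  normalises the nonzero diagonal entries to \<open>1\<close> or \<open>- 1\<close>; indices with
  \<open>l i = 0\<close> contribute nothing to the form.\<close>

lemma has_inertia_frame:
  fixes B :: "'a::euclidean_space \<Rightarrow> 'a \<Rightarrow> real"
  assumes B: "bilinear B" and sym: "\<And>x y. B x y = B y x" and inertia: "has_inertia B np nm n0"
  obtains P N :: "nat set" and e where "finite P" "finite N" "P \<inter> N = {}" "card P = np" "card N = nm"
    and "\<And>i j. i \<in> P \<union> N \<Longrightarrow> j \<in> P \<union> N \<Longrightarrow>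
      B (e i) (e j) = (if i = j then if i \<in> P then 1 else - 1 else 0)"
    and "\<And>y. B y y = (\<Sum>i\<in>P. (B y (e i))\<^sup>2) - (\<Sum>i\<in>N. (B y (e i))\<^sup>2)"
proof -
  define n where "n = DIM('a)"
  obtain bs where bs: "is_basis_list bs"
    and np: "np = size {# l \<in># eigenvalues_mset (gram_matrix B bs). l > 0 #}"
    and nm: "nm = size {# l \<in># eigenvalues_mset (gram_matrix B bs). l < 0 #}"
    using inertia unfolding has_inertia_def by blast
  obtain d l where d: "\<And>i j. i < n \<Longrightarrow> j < n \<Longrightarrow> B (d i) (d j) = (if i = j then l i else 0)"
    and exp: "\<And>y. \<exists>c. y = (\<Sum>i<n. c i *\<^sub>R d i)"
    and ev: "eigenvalues_mset (gram_matrix B bs) = image_mset l (mset_set {..<n})"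
    unfolding n_def using gram_matrix_diagonalisation[OF B sym bs] by blast
  define P where "P = {i. i < n \<and> l i > 0}"
  define N where "N = {i. i < n \<and> l i < 0}"
  define e where "e i = (1 / sqrt \<bar>l i\<bar>) *\<^sub>R d i" for i
  note simps = bilinear_lmul[OF B] bilinear_rmul[OF B]
  have count: "size {# x \<in># image_mset l (mset_set {..<n}). R x #} = card {i. i < n \<and> R (l i)}" for R
  proof -
    have "{i \<in> {..<n}. R (l i)} = {i. i < n \<and> R (l i)}" by auto
    then show ?thesis by (simp add: filter_mset_image_mset)
  qed
  have orth: "B (e i) (e j) = (if i = j then if i \<in> P then 1 else - 1 else 0)"
    if "i \<in> P \<union> N" "j \<in> P \<union> N" for i j
  proof -
    have ij: "i < n" "j < n" "l i \<noteq> 0" using that by (auto simp: P_def N_def)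
    have "B (e i) (e j) = (if i = j then l i / \<bar>l i\<bar> else 0)"
      using d[OF ij(1,2)] by (auto simp: e_def simps)
    then show ?thesis using ij by (auto simp: P_def)
  qed
  have quad: "B y y = (\<Sum>i\<in>P. (B y (e i))\<^sup>2) - (\<Sum>i\<in>N. (B y (e i))\<^sup>2)" for y
  proof -
    obtain c where c: "y = (\<Sum>i<n. c i *\<^sub>R d i)" using exp by blast
    \<comment> \<open>This expresses the squares through the values \<open>B y (e i)\<close>, which
      are linear in \<open>y\<close>, instead of through the coefficients
      \<open>c i\<close>.\<close>
    have yd: "B y (d j) = c j * l j" if "j < n" for j
    proof -
      have "linear (\<lambda>x. B x (d j))" using B by (simp add: bilinear_def)
      from linear_sum[OF this, of "\<lambda>i. c i *\<^sub>R d i" "{..<n}"]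
      have "B y (d j) = (\<Sum>i<n. c i * B (d i) (d j))" by (simp add: c simps)
      also have "\<dots> = (\<Sum>i<n. if i = j then c j * l j else 0)"
        using that by (intro sum.cong) (auto simp: d)
      finally show ?thesis using that by simp
    qed
    have "linear (B y)" using B by (simp add: bilinear_def)
    then have "B y y = (\<Sum>i<n. c i * B y (d i))"
      using arg_cong[OF c, of "B y"] by (simp add: linear_sum linear_scale)
    also have "\<dots> = (\<Sum>i<n. (c i)\<^sup>2 * l i)"
      by (intro sum.cong) (auto simp: yd power2_eq_square)
    also have "\<dots> = (\<Sum>i\<in>P \<union> N. (c i)\<^sup>2 * l i)"
      by (rule sum.mono_neutral_right) (auto simp: P_def N_def)
    also have "\<dots> = (\<Sum>i\<in>P. (c i)\<^sup>2 * l i) + (\<Sum>i\<in>N. (c i)\<^sup>2 * l i)"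
      by (rule sum.union_disjoint) (auto simp: P_def N_def)
    also have "(\<Sum>i\<in>P. (c i)\<^sup>2 * l i) = (\<Sum>i\<in>P. (B y (e i))\<^sup>2)"
      by (intro sum.cong) (auto simp: P_def e_def simps yd power_divide power_mult_distrib power2_eq_square)
    also have "(\<Sum>i\<in>N. (c i)\<^sup>2 * l i) = - (\<Sum>i\<in>N. (B y (e i))\<^sup>2)"
      unfolding sum_negf[symmetric]
      by (intro sum.cong) (auto simp: N_def e_def simps yd power_divide power_mult_distrib power2_eq_square)
    finally show ?thesis by simp
  qed
  show thesis
  proof (rule that[of P N e])
    show "finite P" "finite N" "P \<inter> N = {}" by (auto simp: P_def N_def)
    show "card P = np" unfolding P_def np ev count ..
    show "card N = nm" unfolding N_def nm ev count ..
  qed (use orth quad in blast)+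
qed

section \<open>The main theorem\<close>

context symmetric_form
begin

lemma exists_isometry:
  assumes "B x x = 1" "B p p = 1"
  obtains R where "\<And>y z. B (R y) (R z) = B y z" and "R p = x \<or> R p = - x"
proof -
  text \<open>The reflections exchanging \<open>x\<close> with \<open>p\<close> and with \<open>- p\<close>; not both mirrors are null.\<close>
  note goal = that
  have reflect: thesis if q: "q = p \<or> q = - p" and w: "B x q \<noteq> 1" for q
  proof -
    define w where "w = q - x"
    have qq: "B q q = 1" using q assms by (auto simp: form_simps)
    have ww: "B w w = 2 - 2 * B x q"
      using assms qq by (simp add: w_def form_simps sym[of q x])
    define R where "R y = y - (2 * B y w / B w w) *\<^sub>R w" for y
    have "B w w \<noteq> 0" using w ww by simp
    then have iso: "B (R y) (R z) = B y z" for y z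
      by (simp add: R_def form_simps sym[of w z] field_simps)
    have "B q w = B w w / 2" using ww qq by (simp add: w_def form_simps sym[of q x])
    then have "2 * B q w / B w w = 1" using \<open>B w w \<noteq> 0\<close> by simp
    then have "R q = x" unfolding R_def by (simp add: w_def)
    moreover have "R (- p) = - R p" by (simp add: R_def form_simps)
    ultimately show thesis using goal[OF iso] q by (auto simp: minus_equation_iff)
  qed
  show thesis
  proof (cases "B x p = 1")
    case True
    then have "B x (- p) \<noteq> 1" by (simp add: form_simps)
    then show ?thesis by (intro reflect[of "- p"]) auto
  next
    case False
    then show ?thesis by (intro reflect[of p]) auto
  qed
qed

text \<open>The functional \<open>B x p\<close> has no zero on the connected set \<open>C\<close>,
  hence a constant sign, and may be replaced by a positive linear form \<open>l\<close> with the
  same square.\<close>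

lemma diff_monotone_on_lorentz_form:
  assumes C: "open_convex_cone C" and pos: "\<And>x. x \<in> C \<Longrightarrow> B x x > 0" and N: "finite N"
    and quad: "\<And>y. B y y = (B y p)\<^sup>2 - (\<Sum>i\<in>N. (B y (e i))\<^sup>2)"
    and \<beta>: "N = {} \<and> \<beta> \<ge> 0 \<or> N \<noteq> {} \<and> (\<beta> = 0 \<or> \<beta> \<ge> (real (card N) - 1) / 2)"
  shows "diff_monotone_on C (\<lambda>x. B x x powr (- \<beta>))"
proof -
  have "B x p \<noteq> 0" if "x \<in> C" for x
    using pos[OF that] quad[of x] sum_nonneg[of N "\<lambda>i. (B x (e i))\<^sup>2"] by auto
  moreover have "connected ((\<lambda>x. B x p) ` C)"
    using C by (intro connected_continuous_image linear_continuous_on bounded_linear_form)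
      (simp add: open_convex_cone_def convex_connected)
  ultimately have "(\<forall>x\<in>C. B x p > 0) \<or> (\<forall>x\<in>C. B x p < 0)"
    by (smt (verit) connected_contains_Icc atLeastAtMost_iff imageE imageI subsetD)
  then obtain l where l: "bounded_linear l" "\<And>x. x \<in> C \<Longrightarrow> l x > 0"
    and l2: "\<And>x. (l x)\<^sup>2 = (B x p)\<^sup>2"
  proof
    assume "\<forall>x\<in>C. B x p > 0"
    then show ?thesis using that[OF bounded_linear_form[of p]] by simp
  next
    assume "\<forall>x\<in>C. B x p < 0"
    then show ?thesis using that[OF bounded_linear_minus[OF bounded_linear_form[of p]]] by simp
  qed
  consider "\<beta> = 0" | "N = {}" "\<beta> \<ge> 0" | "N \<noteq> {}" "\<beta> \<ge> (real (card N) - 1) / 2" using \<beta> by blast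
  then show ?thesis
  proof cases
    case 1
    \<comment> \<open>The function is constantly 1: \<open>powr\<close> with exponent 0 is 1 for a
      nonzero base, and both \<open>l\<close> and the form are positive on \<open>C\<close>.\<close>
    have "diff_monotone_on C (\<lambda>x. l x powr (- 0))"
      by (intro diff_monotone_on_linear_powr C l) auto
    then show ?thesis
      by (rule iffD1[OF diff_monotone_on_cong[OF C], rotated]) (use 1 l(2) pos in force)
  next
    case 2
    have "diff_monotone_on C (\<lambda>x. l x powr (- \<beta>) * l x powr (- \<beta>))"
      using 2 by (intro diff_monotone_on_mult diff_monotone_on_linear_powr C l) auto
    then show ?thesis
    proof (rule iffD1[OF diff_monotone_on_cong[OF C], rotated])
      fix x assume "x \<in> C"
      have "B x x = l x * l x" using 2 quad[of x] l2[of x] by (simp add: power2_eq_square)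
      then show "l x powr (- \<beta>) * l x powr (- \<beta>) = B x x powr (- \<beta>)"
        using l(2)[OF \<open>x \<in> C\<close>] by (simp add: powr_mult)
    qed
  next
    case 3
    then obtain k where k: "k \<in> N" by blast
    obtain js where js: "distinct js" "set js = N - {k}" using N finite_distinct_list[of "N - {k}"] by auto
    have "card N \<ge> 1" using N k by (auto simp: Suc_le_eq card_gt_0_iff)
    moreover have "length js = card N - 1" using distinct_card[OF js(1)] js(2) k by simp
    ultimately have len: "real (length js) = real (card N) - 1" by simp
    define zs where "zs = map (\<lambda>j x. B x (e j)) js"
    \<comment> \<open>Null coordinates: \<open>u * v\<close> absorbs the negative square of index
      \<open>k\<close>, leaving \<open>card N - 1\<close> squares.\<close>
    define u v where "u x = l x + B x (e k)" and "v x = l x - B x (e k)" for x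
    have zs: "(\<Sum>z\<leftarrow>zs. (z x)\<^sup>2) = (\<Sum>j\<in>N - {k}. (B x (e j))\<^sup>2)" for x
      using js by (simp add: zs_def o_def sum_list_distinct_conv_sum_set)
    have uv: "B x x = u x * v x - (\<Sum>z\<leftarrow>zs. (z x)\<^sup>2)" for x
      unfolding zs u_def v_def using N k quad[of x] l2[of x]
      by (simp add: sum.remove[of N k] algebra_simps power2_eq_square)
    have S: "0 \<le> (\<Sum>z\<leftarrow>zs. (z x)\<^sup>2)" for x by (auto simp: zs intro!: sum_nonneg)
    have lin: "bounded_linear u" "bounded_linear v"
      unfolding u_def v_def by (intro bounded_linear_add bounded_linear_sub l bounded_linear_form)+
    have lt: "(\<Sum>z\<leftarrow>zs. (z x)\<^sup>2) < u x * v x" if "x \<in> C" for x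
      using pos[OF that] uv[of x] by simp
    \<comment> \<open>The product \<open>u * v\<close> and the sum \<open>u + v = 2 * l\<close> are
      both positive.\<close>
    have u: "u x > 0" if "x \<in> C" for x
    proof -
      have "0 < u x * v x" using lt[OF that] S[of x] by linarith
      moreover have "u x + v x > 0" using l(2)[OF that] by (simp add: u_def v_def)
      ultimately show ?thesis by (auto simp: zero_less_mult_iff)
    qed
    have "diff_monotone_on C (\<lambda>x. u x powr (- \<beta>) * (v x - (\<Sum>z\<leftarrow>zs. (z x)\<^sup>2) / u x) powr (- \<beta>))"
    proof (rule diff_monotone_on_lorentz_powr[OF C lin(1) u lin(2) _ lt])
      show "bounded_linear z" if "z \<in> set zs" for z
        using that by (auto simp: zs_def bounded_linear_form)
      \<comment> \<open>If a square remains, then \<open>card N \<ge> 2\<close>, and the bound on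
        \<open>\<beta>\<close> already gives \<open>\<beta> \<ge> 1/2\<close>.\<close>
      have "length js > 0 \<Longrightarrow> real (length js) \<ge> 1" by linarith
      then show "\<beta> \<ge> real (length zs) / 2" "\<beta> \<ge> 0" "zs \<noteq> [] \<Longrightarrow> \<beta> \<ge> 1/2"
        using 3 len by (auto simp: zs_def)
    qed
    then show ?thesis
    proof (rule iffD1[OF diff_monotone_on_cong[OF C], rotated])
      fix x assume x: "x \<in> C"
      have "B x x = u x * (v x - (\<Sum>z\<leftarrow>zs. (z x)\<^sup>2) / u x)" using uv[of x] u[OF x] by (simp add: right_diff_distrib)
      moreover have "v x - (\<Sum>z\<leftarrow>zs. (z x)\<^sup>2) / u x > 0" using lt[OF x] u[OF x] by (simp add: field_simps)
      ultimately show "u x powr (- \<beta>) * (v x - (\<Sum>z\<leftarrow>zs. (z x)\<^sup>2) / u x) powr (- \<beta>) = B x x powr (- \<beta>)"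
        using u[OF x] by (simp add: powr_mult)
    qed
  qed
qed

text \<open>In coordinates the form is a finite sum of products of linear functions, and it is
  positive on \<open>C\<close>.\<close>

lemma Cinf_on_form_powr:
  assumes C: "open C" and pos: "\<And>x. x \<in> C \<Longrightarrow> B x x > 0"
  shows "Cinf_on (\<lambda>x. B x x powr a) C"
proof -
  have "B x x = (\<Sum>b\<in>Basis. inner b x * B x b)" for x
  proof -
    have "linear (B x)" using bil by (simp add: bilinear_def)
    from linear_sum[OF this, of "\<lambda>b. inner x b *\<^sub>R b" Basis] show ?thesis
      by (simp add: euclidean_representation form_simps) (simp only: inner_commute)
  qed
  moreover have "Ck_on k (\<lambda>x. \<Sum>b\<in>S. inner b x * B x b) C" if "finite S" for k S
    using that
  proof induction
    case (insert b S)
    have "Ck_on k (\<lambda>x. inner b x * B x b) C"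
      by (intro Ck_on_mult C Ck_on_bounded_linear bounded_linear_form bounded_linear_inner_right)
    then show ?case using insert by (simp add: Ck_on_add[OF C])
  qed (simp add: Ck_on_const)
  ultimately have "Ck_on k (\<lambda>x. B x x) C" for k by simp
  then show ?thesis unfolding Cinf_on_def using C pos by (intro allI Ck_on_powr)
qed

end

theorem theorem1p9:
  fixes B :: "'a::euclidean_space \<Rightarrow> 'a \<Rightarrow> real"
    and Q :: "'a \<Rightarrow> real"
    and C :: "'a set"
    and np nm n0 :: nat
  assumes bil: "bilinear B"
    and sym: "\<And>x y. B x y = B y x"
    and inertia: "has_inertia B np nm n0"
    and Q: "\<And>x. Q x = B x x"
    and C: "open_convex_cone C" "C \<noteq> {}"
    and pos: "\<And>x. x \<in> C \<Longrightarrow> Q x > 0"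
  shows "np \<ge> 1 \<and>
    (np = 1 \<and> nm = 0 \<longrightarrow>
       (\<forall>\<beta>::real. \<beta> \<ge> 0 \<longrightarrow>
          completely_monotone_on C (\<lambda>x. Q x powr (-\<beta>))) \<and>
       (\<forall>\<beta>::real. \<not> \<beta> \<ge> 0 \<longrightarrow>
          (\<forall>C'. open_convex_cone C' \<and> C' \<noteq> {} \<and> C' \<subseteq> C \<longrightarrow>
             \<not> completely_monotone_on C' (\<lambda>x. Q x powr (-\<beta>))))) \<and>
    (np = 1 \<and> nm \<ge> 1 \<longrightarrow>
       (\<forall>\<beta>::real. \<beta> = 0 \<or> \<beta> \<ge> (real nm - 1) / 2 \<longrightarrow>
          completely_monotone_on C (\<lambda>x. Q x powr (-\<beta>))) \<and>
       (\<forall>\<beta>::real. \<not> (\<beta> = 0 \<or> \<beta> \<ge> (real nm - 1) / 2) \<longrightarrow>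
          (\<forall>C'. open_convex_cone C' \<and> C' \<noteq> {} \<and> C' \<subseteq> C \<longrightarrow>
             \<not> completely_monotone_on C' (\<lambda>x. Q x powr (-\<beta>))))) \<and>
    (np > 1 \<longrightarrow>
       (\<forall>\<beta>::real. \<beta> \<noteq> 0 \<longrightarrow>
          (\<forall>C'. open_convex_cone C' \<and> C' \<noteq> {} \<and> C' \<subseteq> C \<longrightarrow>
             \<not> completely_monotone_on C' (\<lambda>x. Q x powr (-\<beta>)))))"
proof -
  interpret symmetric_form B using bil sym by unfold_locales
  have Q': "Q = (\<lambda>x. B x x)" using Q by blast
  have posB: "B x x > 0" if "x \<in> C" for x using pos[OF that] Q by simp
  obtain P N :: "nat set" and e where PN: "finite P" "finite N" "P \<inter> N = {}" "card P = np" "card N = nm"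
    and orth: "\<And>i j. i \<in> P \<union> N \<Longrightarrow> j \<in> P \<union> N \<Longrightarrow>
      B (e i) (e j) = (if i = j then if i \<in> P then 1 else - 1 else 0)"
    and quad: "\<And>y. B y y = (\<Sum>i\<in>P. (B y (e i))\<^sup>2) - (\<Sum>i\<in>N. (B y (e i))\<^sup>2)"
    using has_inertia_frame[OF bil sym inertia] by blast
  have "P \<noteq> {}"
  proof
    assume "P = {}"
    obtain x where "x \<in> C" using C by blast
    from posB[OF this] quad[of x] \<open>P = {}\<close> sum_nonneg[of N "\<lambda>i. (B x (e i))\<^sup>2"] show False by simp
  qed
  then obtain p where p: "p \<in> P" by blast
  have np: "np \<ge> 1" using PN \<open>P \<noteq> {}\<close> by (simp add: Suc_le_eq card_gt_0_iff flip: PN(4))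
  \<comment> \<open>The positive claims of (a) and (b) together.\<close>
  have cm: "completely_monotone_on C (\<lambda>x. B x x powr (- \<beta>))"
    if "np = 1" "nm = 0 \<and> \<beta> \<ge> 0 \<or> nm \<noteq> 0 \<and> (\<beta> = 0 \<or> \<beta> \<ge> (real nm - 1) / 2)" for \<beta>
  proof (rule diff_monotone_on_imp_completely_monotone_on[OF C(1)])
    have "P = {p}" using p PN \<open>np = 1\<close> by (auto simp: card_1_singleton_iff)
    then show "diff_monotone_on C (\<lambda>x. B x x powr (- \<beta>))"
      using that(2) PN quad
      by (intro diff_monotone_on_lorentz_form[where p = "e p" and e = e and N = N, OF C(1) posB]) auto
    show "Cinf_on (\<lambda>x. B x x powr (- \<beta>)) C"
      using C posB by (intro Cinf_on_form_powr) (simp_all add: open_convex_cone_def)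
  qed
  \<comment> \<open>The negative claims of (a), (b) and (c) together.\<close>
  have not_cm: "\<not> completely_monotone_on C' (\<lambda>x. B x x powr (- \<beta>))"
    if C': "open_convex_cone C'" "C' \<noteq> {}" "C' \<subseteq> C"
      and \<beta>: "\<beta> < 0 \<or> \<beta> > 0 \<and> (np > 1 \<or> \<beta> < (real nm - 1) / 2)" for C' \<beta>
  proof
    assume "completely_monotone_on C' (\<lambda>x. B x x powr (- \<beta>))"
    then have dm: "diff_monotone_on C' (\<lambda>x. B x x powr (- \<beta>))"
      by (rule completely_monotone_on_imp_diff_monotone_on[OF C'(1)])
    have "\<beta> \<ge> 0" using C' posB by (intro diff_monotone_on_exponent_nonneg[OF C'(1,2) _ dm]) auto
    with \<beta> have \<beta>: "\<beta> > 0" "np > 1 \<or> \<beta> < (real nm - 1) / 2" by auto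
    obtain y where y: "y \<in> C'" using C' by blast
    then have By: "B y y > 0" using C' posB by blast
    define x where "x = (1 / sqrt (B y y)) *\<^sub>R y"
    have x: "x \<in> C'" "B x x = 1"
      using open_convex_cone_scale[OF C'(1) y] By by (simp_all add: x_def form_simps)
    \<comment> \<open>The isometry carries the frame to one adapted to the point \<open>x\<close> of
      the subcone, up to sign in the direction \<open>p\<close>.\<close>
    obtain R where R: "\<And>y z. B (R y) (R z) = B y z" and Rp: "R (e p) = x \<or> R (e p) = - x"
      using exists_isometry[OF x(2), of "e p"] orth[of p p] p by auto
    have xR: "B x (R (e i)) = 0" if "i \<in> P \<union> N" "i \<noteq> p" for i
    proof -
      have "B (R (e p)) (R (e i)) = 0" using R orth[of p i] that p by simp
      then show ?thesis using Rp by (auto simp: form_simps)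
    qed
    show False using \<beta>(2)
    proof
      assume "np > 1"
      then obtain q where q: "q \<in> P" "q \<noteq> p" using PN p by (metis card_le_Suc0_iff_eq One_nat_def leD)
      then have "B x (R (e q)) = 0" "B (R (e q)) (R (e q)) = 1"
        using xR[of q] R[of "e q" "e q"] orth[of q q] by auto
      then show False
        using not_diff_monotone_on_orthogonal_pos[OF C'(1) x(1), of "R (e q)" \<beta>] x(2) \<beta>(1) dm by simp
    next
      assume lt: "\<beta> < (real nm - 1) / 2"
      have pN: "p \<notin> N" using p PN by blast
      have iN: "i \<noteq> p" "i \<notin> P" if "i \<in> N" for i using that pN PN by auto
      \<comment> \<open>Index \<open>p\<close> gets \<open>x\<close> itself, since
        \<open>R (e p)\<close> may be \<open>- x\<close> while the base point has to lie in
        \<open>C'\<close>.\<close>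
      define f where "f i = (if i = p then x else R (e i))" for i
      have "\<not> diff_monotone_on C' (\<lambda>x. B x x powr (- \<beta>))"
      proof (rule not_diff_monotone_on_small_exponent[of C' \<beta> N p f])
        show "B (f i) (f j) = (if i = j then - 1 else 0)" if "i \<in> N" "j \<in> N" for i j
          using that iN[of i] iN[of j] R orth[of i j] by (auto simp: f_def)
        show "B (f p) (f i) = 0" if "i \<in> N" for i
          using that iN[of i] xR[of i] by (auto simp: f_def)
      qed (use C' \<beta> lt PN pN x in \<open>auto simp: f_def\<close>)
      with dm show False by simp
    qed
  qed
  show ?thesis
    unfolding Q'
  proof (intro conjI impI allI)
    show "np \<ge> 1" by (rule np)
    show "completely_monotone_on C (\<lambda>x. B x x powr (- \<beta>))" if "np = 1 \<and> nm = 0" "\<beta> \<ge> 0" for \<beta>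
      by (rule cm) (use that in auto)
    show "\<not> completely_monotone_on C' (\<lambda>x. B x x powr (- \<beta>))"
      if "np = 1 \<and> nm = 0" "\<not> \<beta> \<ge> 0" "open_convex_cone C' \<and> C' \<noteq> {} \<and> C' \<subseteq> C" for \<beta> C'
      by (rule not_cm) (use that in auto)
    show "completely_monotone_on C (\<lambda>x. B x x powr (- \<beta>))" if "np = 1 \<and> nm \<ge> 1" "\<beta> = 0 \<or> \<beta> \<ge> (real nm - 1) / 2" for \<beta>
      by (rule cm) (use that in auto)
    show "\<not> completely_monotone_on C' (\<lambda>x. B x x powr (- \<beta>))"
      if "np = 1 \<and> nm \<ge> 1" "\<not> (\<beta> = 0 \<or> \<beta> \<ge> (real nm - 1) / 2)" "open_convex_cone C' \<and> C' \<noteq> {} \<and> C' \<subseteq> C" for \<beta> C'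
      by (rule not_cm) (use that in auto)
    show "\<not> completely_monotone_on C' (\<lambda>x. B x x powr (- \<beta>))"
      if "np > 1" "\<beta> \<noteq> 0" "open_convex_cone C' \<and> C' \<noteq> {} \<and> C' \<subseteq> C" for \<beta> C'
      by (rule not_cm) (use that in auto)
  qed
qed

end
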